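(* Let $p,q,r,s$ be integers with $r,s>0$, $r+s=q-1$ and $r+s\leq p-2$. Let $K=\mathrm S(\mathrm{GL}(p)\times\mathrm{GL}(q))$, let $Ke\subset\mathfrak p$ be the spherical nilpotent $K$-orbit with signed partition $(+3,+2^r,-2^s,+1^{p-r-s-2})$, and let $X$ be the wonderful compactification of $K/\mathrm N_K(K_e)$, with set of spherical roots $\Sigma$ and set of colors $\Delta$. Put $r_1=r$, $r_2=s$. The semigroup $$\Gamma_{\Delta_{\mathfrak p}(e)}=\{(n_1,n_2,E)\in\mathbb N^2\times\mathbb N\Delta : E\leq_\Sigma n_1D_{\mathfrak p_1}+n_2D_{\mathfrak p_2}\}$$ is generated by the elements $(i,0,\tilde D^1_{2i})$ for $1\leq i\leq r_1+1$, $(0,j,\tilde D^2_{2j})$ for $1\leq j\leq r_2+1$, and $(i,j,\tilde D^1_{2i-1}+\tilde D^2_{2j-1})$ for $1\leq i\leq r_1+1$, $1\leq j\leq r_2+1$ with $i+j<r_1+r_2+2$.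
   Context: Everything is over $\mathbb C$; $\mathbb N$ contains $0$. Let $G=\mathrm{SL}(p+q)\supset K$. Let $e_1,\dots,e_p$ be a basis of $\mathbb C^p$ with dual basis $\varphi_1,\dots,\varphi_p$, and $e'_1,\dots,e'_q$ a basis of $\mathbb C^q$ with dual basis $\varphi'_1,\dots,\varphi'_q$. The isotropy representation is $\mathfrak p=\mathfrak p_1\oplus\mathfrak p_2$, $\mathfrak p_1=\mathbb C^p\otimes(\mathbb C^q)^*$, $\mathfrak p_2=(\mathbb C^p)^*\otimes\mathbb C^q$. A representative of the orbit is $$e=e_1\otimes\varphi'_{q-r}+\sum_{i=1}^re_{i+1}\otimes\varphi'_{q-r+i}+\sum_{i=1}^s\varphi_{p-s+i-1}\otimes e'_i+\varphi_p\otimes e'_{q-r}.$$ Let $B\subset K$ be the standard Borel subgroup; $\alpha_1,\dots,\alpha_{p-1}$ and $\alpha'_1,\dots,\alpha'_{q-1}$ are the simple roots of $\mathrm{GL}(p)$ and $\mathrm{GL}(q)$. A wonderful $K$-variety is a smooth projective $K$-variety with an open $K$-orbit whose complement is a union of smooth prime divisors with normal crossings and non-empty total intersection, such that two points are in the same orbit if and only if they lie in the same boundary divisors. The homogeneous space $K/\mathrm N_K(K_e)$ is the open orbit of a unique wonderful $K$-variety $X$. Its set of colors $\Delta$ is the set of $B$-stable, non-$K$-stable prime divisors; $\mathrm{Pic}(X)=\mathbb Z\Delta$, writing $\mathcal L_D$ for the line bundle of $D$, and $\mathbb N\Delta$ corresponds to the globally generated line bundles. The set of spherical roots $\Sigma$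 is the set of $T$-weights on $\mathrm T_{y_0}X/\mathrm T_{y_0}Y$, with $T\subset B$ the maximal torus, $Y$ the closed orbit and $y_0\in Y$ the point fixed by the opposite Borel subgroup; spherical roots correspond bijectively to $K$-stable prime divisors, so that $\mathbb Z\Sigma\subset\mathrm{Pic}(X)=\mathbb Z\Delta$. For $D,E\in\mathbb N\Delta$, $D\leq_\Sigma E$ means $E-D\in\mathbb N\Sigma$. A simple root $\alpha$ moves a color $D$ if $P_\alpha D\neq D$, where $P_\alpha\supset B$ is the minimal parabolic subgroup of $\alpha$. Here $\Sigma=\{\sigma^1_1,\dots,\sigma^1_{2r},\sigma^2_1,\dots,\sigma^2_{2s}\}$ with $\sigma^1_{2i-1}=\alpha_{p-i}$, $\sigma^1_{2i}=\alpha'_i$ ($1\leq i\leq r$), $\sigma^2_{2i-1}=\alpha_i$, $\sigma^2_{2i}=\alpha'_{q-i}$ ($1\leq i\leq s$). The colors are $\Delta=\{D^1_1,\dots,D^1_{2r_1+2},D^2_1,\dots,D^2_{2r_2+2}\}$, where for $k=1,2$: $D^k_1$ is the color moved by $\sigma^k_1$ only; $D^k_h$ ($2\leq h\leq2r_k$) is the color moved by $\sigma^k_{h-1}$ and $\sigma^k_h$; $D^k_{2r_k+1}$ is the color moved by $\sigma^k_{2r_k}$ only; $D^1_{2r+2}$ is the color moved by $\alpha_{p-r-1}$ and $D^2_{2s+2}$ the color moved by $\alpha_{s+1}$ (these two coincide if $p=q+1$, and otherwise all listed colors are distinct). Define also $D^1_{2r_1+3}=D^2_{2r_2+1}$ and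 $D^2_{2r_2+3}=D^1_{2r_1+1}$, and for $k=1,2$ put $$\tilde D^k_h=D^k_h\ \text{ if } h<2r_k+1,\qquad \tilde D^k_h=D^k_h+D^k_{h+1}\ \text{ if } h\in\{2r_k+1,2r_k+2\}.$$ In $\mathbb Z\Delta$, with $\tilde D^k_0=0$, one has $\sigma^k_h=-\tilde D^k_{h-1}+\tilde D^k_h+\tilde D^k_{h+1}-\tilde D^k_{h+2}$ for $1\leq h\leq2r_k$. For $i=1,2$, $D_{\mathfrak p_i}\in\mathbb N\Delta$ is the element such that $\mathcal L_{D_{\mathfrak p_i}}$ is the pullback of $\mathcal O(1)$ along the equivariant morphism $X\to\mathbb P(\mathfrak p_i)$ extending the map induced by the projection $Ke\to\mathfrak p_i$; here $D_{\mathfrak p_1}=D^1_2$ and $D_{\mathfrak p_2}=D^2_2$. $\Delta_{\mathfrak p}(e)=\{D_{\mathfrak p_1},D_{\mathfrak p_2}\}$. *)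

theory Defs
  imports
    "HOL-Analysis.Analysis"
    "HOL-Library.Poly_Mapping"
    "HOL-Library.Product_Plus"
    "Jordan_Normal_Form.Determinant"
    "Jordan_Normal_Form.Gauss_Jordan_Elimination"
begin

section \<open>Generated semigroups and polynomial functions\<close>

text \<open>Semigroups contain \<open>0\<close>, as in \<open>\<nat>\<Delta>\<close> and \<open>\<nat>\<Sigma>\<close>.\<close>

inductive_set semigroup_gen :: "'a::comm_monoid_add set \<Rightarrow> 'a set"
  for S :: "'a set"
where
  zero: "0 \<in> semigroup_gen S"
| add: "x \<in> S \<Longrightarrow> y \<in> semigroup_gen S \<Longrightarrow> x + y \<in> semigroup_gen S"

inductive_set poly_funs :: "('a \<Rightarrow> complex) set \<Rightarrow> ('a \<Rightarrow> complex) set"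
  for C :: "('a \<Rightarrow> complex) set"
where
  const: "(\<lambda>_. c) \<in> poly_funs C"
| coord: "f \<in> C \<Longrightarrow> f \<in> poly_funs C"
| add: "f \<in> poly_funs C \<Longrightarrow> g \<in> poly_funs C \<Longrightarrow> (\<lambda>x. f x + g x) \<in> poly_funs C"
| mult: "f \<in> poly_funs C \<Longrightarrow> g \<in> poly_funs C \<Longrightarrow> (\<lambda>x. f x * g x) \<in> poly_funs C"


section \<open>Projective varieties\<close>

text \<open>A subset of the projective space of \<open>V = complex^'n\<close> is represented by its punctured cone,
  i.e. by the set of all nonzero vectors that span one of its points.\<close>

definition polys :: "(complex^'n \<Rightarrow> complex) set" where
  "polys = poly_funs {(\<lambda>x. vec_nth x i) | i. True}"

definition forms :: "nat \<Rightarrow> (complex^'n \<Rightarrow> complex) set" where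
  "forms d = {f \<in> polys. \<forall>c x. f (c *s x) = c ^ d * f x}"

definition zariski_closed :: "(complex^'n) set \<Rightarrow> bool" where
  "zariski_closed Z \<longleftrightarrow>
     (\<exists>F \<subseteq> (\<Union>d. forms d). Z = {x. x \<noteq> 0 \<and> (\<forall>f\<in>F. f x = 0)})"

definition irreducible_closed :: "(complex^'n) set \<Rightarrow> bool" where
  "irreducible_closed Z \<longleftrightarrow> zariski_closed Z \<and> Z \<noteq> {} \<and>
     (\<forall>Z1 Z2. zariski_closed Z1 \<and> zariski_closed Z2 \<and> Z = Z1 \<union> Z2 \<longrightarrow> Z = Z1 \<or> Z = Z2)"

text \<open>Krull dimension of the projective variety, not of its cone.\<close>

definition proj_dim :: "(complex^'n) set \<Rightarrow> nat" where
  "proj_dim Z = (GREATEST n. \<exists>C. (\<forall>i\<le>n. irreducible_closed (C i) \<and> C i \<subseteq> Z) \<and>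
                                 (\<forall>i<n. C i \<subset> C (Suc i)))"

definition vanishing_ideal :: "(complex^'n) set \<Rightarrow> (complex^'n \<Rightarrow> complex) set" where
  "vanishing_ideal Z = {f \<in> polys. \<forall>x\<in>Z. f x = 0}"

text \<open>The tangent space at \<open>x\<close> of the affine cone over \<open>Z\<close>. The tangent space of the projective
  variety at the point spanned by \<open>x\<close> is the tensor product of (cone tangent space modulo the
  line through \<open>x\<close>) with the dual of that line.\<close>

definition cone_tangent :: "(complex^'n) set \<Rightarrow> complex^'n \<Rightarrow> (complex^'n) set" where
  "cone_tangent Z x =
     {v. \<forall>f\<in>vanishing_ideal Z. deriv (\<lambda>t::complex. f (x + t *s v)) 0 = 0}"

definition smooth_variety :: "(complex^'n) set \<Rightarrow> bool" where
  "smooth_variety Z \<longleftrightarrow> (\<forall>x\<in>Z. vec.dim (cone_tangent Z x) = proj_dim Z + 1)"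

definition prime_divisor :: "(complex^'n) set \<Rightarrow> (complex^'n) set \<Rightarrow> bool" where
  "prime_divisor X Z \<longleftrightarrow> irreducible_closed Z \<and> Z \<subset> X \<and>
     \<not> (\<exists>W. irreducible_closed W \<and> Z \<subset> W \<and> W \<subset> X)"

text \<open>For smooth divisors on a smooth variety, normal crossings means that at every point the
  tangent hyperplanes of the divisors through that point are linearly independent.\<close>

definition normal_crossings :: "(complex^'n) set \<Rightarrow> (complex^'n) set set \<Rightarrow> bool" where
  "normal_crossings X \<D> \<longleftrightarrow>
     (\<forall>x\<in>X. vec.dim (cone_tangent X x \<inter> (\<Inter>Z\<in>{Z\<in>\<D>. x \<in> Z}. cone_tangent Z x))
             + card {Z\<in>\<D>. x \<in> Z} = vec.dim (cone_tangent X x))"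


section \<open>Divisors and linear equivalence\<close>

text \<open>Weil divisors are elements of the free abelian group \<open>(complex^'n) set \<Rightarrow>\<^sub>0 int\<close>
  supported on prime divisors; \<open>frag_of Z\<close> is the basis element of \<open>Z\<close>. On a smooth \<open>X\<close> the
  Picard group is the group of Weil divisors modulo linear equivalence.\<close>

definition ideal_power ::
  "(complex^'n \<Rightarrow> complex) set \<Rightarrow> nat \<Rightarrow> (complex^'n \<Rightarrow> complex) set" where
  "ideal_power I n = {(\<lambda>x. \<Sum>j<m. c j x * (\<Prod>i<n. g j i x)) | (m::nat) c g.
     \<forall>j<m. c j \<in> polys \<and> (\<forall>i<n. g j i \<in> I)}"

text \<open>The valuation of the local ring of the cone over \<open>X\<close> along the cone over \<open>Z\<close>: \<open>f\<close> lies in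
  the \<open>n\<close>-th power of the maximal ideal iff \<open>h f\<close> agrees on \<open>X\<close> with an element of the \<open>n\<close>-th
  power of the ideal of \<open>Z\<close>, for some \<open>h\<close> not vanishing identically on \<open>Z\<close>.\<close>

definition ord_along ::
  "(complex^'n) set \<Rightarrow> (complex^'n) set \<Rightarrow> (complex^'n \<Rightarrow> complex) \<Rightarrow> nat" where
  "ord_along X Z f = (GREATEST n. \<exists>h\<in>polys. \<exists>g\<in>ideal_power (vanishing_ideal Z) n.
     (\<exists>x\<in>Z. h x \<noteq> 0) \<and> (\<forall>x\<in>X. h x * f x = g x))"

definition weil_divisor :: "(complex^'n) set \<Rightarrow> ((complex^'n) set \<Rightarrow>\<^sub>0 int) \<Rightarrow> bool" where
  "weil_divisor X E \<longleftrightarrow> (\<forall>Z\<in>Poly_Mapping.keys E. prime_divisor X Z)"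

text \<open>Rational functions on \<open>X\<close> are quotients \<open>f / g\<close> of forms of the same degree.\<close>

definition lin_equiv ::
  "(complex^'n) set \<Rightarrow> ((complex^'n) set \<Rightarrow>\<^sub>0 int) \<Rightarrow> ((complex^'n) set \<Rightarrow>\<^sub>0 int) \<Rightarrow> bool" where
  "lin_equiv X E E' \<longleftrightarrow> weil_divisor X E \<and> weil_divisor X E' \<and>
     (\<exists>d. \<exists>f\<in>forms d. \<exists>g\<in>forms d. (\<exists>x\<in>X. f x \<noteq> 0) \<and> (\<exists>x\<in>X. g x \<noteq> 0) \<and>
        (\<forall>Z. prime_divisor X Z \<longrightarrow>
           Poly_Mapping.lookup E Z - Poly_Mapping.lookup E' Z
             = int (ord_along X Z f) - int (ord_along X Z g)))"


section \<open>Morphisms to projective spaces of matrices\<close>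

text \<open>A map from \<open>X\<close> to the projective space of \<open>m \<times> n\<close> matrices is given by a function \<open>\<phi>\<close>
  choosing a nonzero representative of each image point; \<open>F\<close> is a tuple of forms that represents
  it on the open set where \<open>F\<close> does not vanish.\<close>

definition represents ::
  "nat \<Rightarrow> nat \<Rightarrow> (complex^'n) set \<Rightarrow> (complex^'n \<Rightarrow> complex mat) \<Rightarrow>
   (complex^'n \<Rightarrow> complex mat) \<Rightarrow> bool" where
  "represents m n X F \<phi> \<longleftrightarrow> (\<forall>x. F x \<in> carrier_mat m n) \<and>
     (\<exists>d. \<forall>i<m. \<forall>j<n. (\<lambda>x. F x $$ (i, j)) \<in> forms d) \<and>
     (\<forall>x\<in>X. F x \<noteq> 0\<^sub>m m n \<longrightarrow> (\<exists>c. c \<noteq> 0 \<and> \<phi> x = c \<cdot>\<^sub>m F x))"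

definition proj_morphism ::
  "nat \<Rightarrow> nat \<Rightarrow> (complex^'n) set \<Rightarrow> (complex^'n \<Rightarrow> complex mat) \<Rightarrow> bool" where
  "proj_morphism m n X \<phi> \<longleftrightarrow>
     (\<forall>x\<in>X. \<phi> x \<in> carrier_mat m n \<and> \<phi> x \<noteq> 0\<^sub>m m n \<and>
        (\<exists>F. represents m n X F \<phi> \<and> F x \<noteq> 0\<^sub>m m n))"

definition linear_form :: "nat \<Rightarrow> nat \<Rightarrow> complex mat \<Rightarrow> complex mat \<Rightarrow> complex" where
  "linear_form m n l M = (\<Sum>i<m. \<Sum>j<n. l $$ (i, j) * M $$ (i, j))"

text \<open>\<open>H\<close> is the divisor of the section of the pullback of \<open>O(1)\<close> defined by some linear form that
  does not vanish identically on the image of \<open>\<phi>\<close>.\<close>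

definition hyperplane_pullback ::
  "nat \<Rightarrow> nat \<Rightarrow> (complex^'n) set \<Rightarrow> (complex^'n \<Rightarrow> complex mat) \<Rightarrow>
   ((complex^'n) set \<Rightarrow>\<^sub>0 int) \<Rightarrow> bool" where
  "hyperplane_pullback m n X \<phi> H \<longleftrightarrow> weil_divisor X H \<and>
     (\<exists>l\<in>carrier_mat m n. (\<exists>x\<in>X. linear_form m n l (\<phi> x) \<noteq> 0) \<and>
        (\<forall>Z F. prime_divisor X Z \<and> represents m n X F \<phi> \<and> (\<exists>x\<in>Z. F x \<noteq> 0\<^sub>m m n) \<longrightarrow>
           Poly_Mapping.lookup H Z = int (ord_along X Z (\<lambda>x. linear_form m n l (F x)))))"


section \<open>The group \<open>K = S(GL(p) \<times> GL(q))\<close> and its isotropy representation\<close>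

type_synonym kelt = "complex mat \<times> complex mat"

definition grpK :: "nat \<Rightarrow> nat \<Rightarrow> kelt set" where
  "grpK p q = {(a, b). a \<in> carrier_mat p p \<and> b \<in> carrier_mat q q \<and>
                       Determinant.det a * Determinant.det b = 1}"

definition kmult :: "kelt \<Rightarrow> kelt \<Rightarrow> kelt" where
  "kmult g h = (fst g * fst h, snd g * snd h)"

definition borel :: "nat \<Rightarrow> nat \<Rightarrow> kelt set" where
  "borel p q = {(a, b) \<in> grpK p q. upper_triangular a \<and> upper_triangular b}"

definition opp_borel :: "nat \<Rightarrow> nat \<Rightarrow> kelt set" where
  "opp_borel p q = {(a, b) \<in> grpK p q.
     upper_triangular (transpose_mat a) \<and> upper_triangular (transpose_mat b)}"

definition torus :: "nat \<Rightarrow> nat \<Rightarrow> kelt set" where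
  "torus p q = {(a, b) \<in> grpK p q. diagonal_mat a \<and> diagonal_mat b}"

text \<open>\<open>SRp i\<close> is the simple root \<open>\<alpha>\<^sub>i\<close> of \<open>GL(p)\<close> and \<open>SRq i\<close> the simple root \<open>\<alpha>'\<^sub>i\<close> of \<open>GL(q)\<close>,
  with \<open>i\<close> counted from 1. Matrix entries are indexed from 0.\<close>

datatype simple_root = SRp nat | SRq nat

definition simple_roots :: "nat \<Rightarrow> nat \<Rightarrow> simple_root set" where
  "simple_roots p q = SRp ` {1..<p} \<union> SRq ` {1..<q}"

text \<open>Characters of the torus are extensional functions, so that equality of functions is equality
  of characters.\<close>

fun root_char :: "nat \<Rightarrow> nat \<Rightarrow> simple_root \<Rightarrow> kelt \<Rightarrow> complex" where
  "root_char p q (SRp i) = restrict (\<lambda>(a, b). a $$ (i - 1, i - 1) / a $$ (i, i)) (torus p q)"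
| "root_char p q (SRq i) = restrict (\<lambda>(a, b). b $$ (i - 1, i - 1) / b $$ (i, i)) (torus p q)"

fun min_parabolic :: "nat \<Rightarrow> nat \<Rightarrow> simple_root \<Rightarrow> kelt set" where
  "min_parabolic p q (SRp i) = {(a, b) \<in> grpK p q.
     (\<forall>k<p. \<forall>l<k. (k, l) \<noteq> (i, i - 1) \<longrightarrow> a $$ (k, l) = 0) \<and> upper_triangular b}"
| "min_parabolic p q (SRq i) = {(a, b) \<in> grpK p q.
     upper_triangular a \<and> (\<forall>k<q. \<forall>l<k. (k, l) \<noteq> (i, i - 1) \<longrightarrow> b $$ (k, l) = 0)}"

text \<open>\<open>\<pp>\<^sub>1 = Hom(\<complex>\<^sup>q, \<complex>\<^sup>p)\<close> is the space of \<open>p \<times> q\<close> matrices and \<open>\<pp>\<^sub>2 = Hom(\<complex>\<^sup>p, \<complex>\<^sup>q)\<close> the space of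
  \<open>q \<times> p\<close> matrices.\<close>

definition p_rows :: "nat \<Rightarrow> nat \<Rightarrow> nat \<Rightarrow> nat" where
  "p_rows p q k = (if k = 1 then p else q)"

definition p_cols :: "nat \<Rightarrow> nat \<Rightarrow> nat \<Rightarrow> nat" where
  "p_cols p q k = (if k = 1 then q else p)"

definition p_act :: "nat \<Rightarrow> kelt \<Rightarrow> complex mat \<Rightarrow> complex mat" where
  "p_act k g M = (if k = 1 then fst g * M * the (mat_inverse (snd g))
                           else snd g * M * the (mat_inverse (fst g)))"

definition unit_entry :: "nat \<Rightarrow> nat \<Rightarrow> nat \<times> nat \<Rightarrow> complex" where
  "unit_entry i j = (\<lambda>(a, b). of_bool (a + 1 = i \<and> b + 1 = j))"

text \<open>The components of the representative \<open>e\<close> of the nilpotent orbit with signed partition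
  \<open>(+3, +2\<^sup>r, -2\<^sup>s, +1\<^bsup>p-r-s-2\<^esup>)\<close>. The tensor \<open>e\<^sub>i \<otimes> \<phi>'\<^sub>j\<close> is the \<open>p \<times> q\<close> matrix unit at \<open>(i, j)\<close>, and
  \<open>\<phi>\<^sub>j \<otimes> e'\<^sub>i\<close> is the \<open>q \<times> p\<close> matrix unit at \<open>(i, j)\<close>.\<close>

definition e_comp :: "nat \<Rightarrow> nat \<Rightarrow> nat \<Rightarrow> nat \<Rightarrow> nat \<Rightarrow> complex mat" where
  "e_comp p q r s k = (if k = 1
     then Matrix.mat p q (\<lambda>ab. unit_entry 1 (q - r) ab + (\<Sum>i=1..r. unit_entry (i + 1) (q - r + i) ab))
     else Matrix.mat q p (\<lambda>ab. (\<Sum>i=1..s. unit_entry i (p - s + i - 1) ab) + unit_entry (q - r) p ab))"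

definition stabilizer_e :: "nat \<Rightarrow> nat \<Rightarrow> nat \<Rightarrow> nat \<Rightarrow> kelt set" where
  "stabilizer_e p q r s =
     {g \<in> grpK p q. \<forall>k\<in>{1, 2}. p_act k g (e_comp p q r s k) = e_comp p q r s k}"

definition normalizerK :: "nat \<Rightarrow> nat \<Rightarrow> kelt set \<Rightarrow> kelt set" where
  "normalizerK p q H = {g \<in> grpK p q. (\<lambda>h. kmult g h) ` H = (\<lambda>h. kmult h g) ` H}"


section \<open>Wonderful \<open>K\<close>-varieties\<close>

text \<open>A projective \<open>K\<close>-variety is realised as a \<open>K\<close>-stable closed subset of the projective space of
  a rational \<open>K\<close>-module. Because \<open>det a * det b = 1\<close> on \<open>K\<close>, the coordinate ring of \<open>K\<close> is
  generated by the matrix entries.\<close>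

definition rational_rep :: "nat \<Rightarrow> nat \<Rightarrow> (kelt \<Rightarrow> complex^'n^'n) \<Rightarrow> bool" where
  "rational_rep p q \<rho> \<longleftrightarrow>
     (\<forall>g\<in>grpK p q. \<forall>h\<in>grpK p q. \<rho> (kmult g h) = \<rho> g ** \<rho> h) \<and>
     \<rho> (1\<^sub>m p, 1\<^sub>m q) = Finite_Cartesian_Product.mat 1 \<and>
     (\<forall>i j. \<exists>f \<in> poly_funs ({(\<lambda>g. fst g $$ (k, l)) | k l. k < p \<and> l < p} \<union>
                             {(\<lambda>g. snd g $$ (k, l)) | k l. k < q \<and> l < q}).
        \<forall>g\<in>grpK p q. vec_nth (vec_nth (\<rho> g) i) j = f g)"

definition stable_under :: "(kelt \<Rightarrow> complex^'n^'n) \<Rightarrow> kelt set \<Rightarrow> (complex^'n) set \<Rightarrow> bool" where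
  "stable_under \<rho> H Z \<longleftrightarrow> (\<forall>g\<in>H. \<forall>x\<in>Z. \<rho> g *v x \<in> Z)"

definition orbit :: "nat \<Rightarrow> nat \<Rightarrow> (kelt \<Rightarrow> complex^'n^'n) \<Rightarrow> complex^'n \<Rightarrow> (complex^'n) set" where
  "orbit p q \<rho> x = {c *s (\<rho> g *v x) | c g. c \<noteq> 0 \<and> g \<in> grpK p q}"

definition point_stabilizer ::
  "nat \<Rightarrow> nat \<Rightarrow> (kelt \<Rightarrow> complex^'n^'n) \<Rightarrow> complex^'n \<Rightarrow> kelt set" where
  "point_stabilizer p q \<rho> x = {g \<in> grpK p q. \<exists>c. \<rho> g *v x = c *s x}"

definition wonderful_variety ::
  "nat \<Rightarrow> nat \<Rightarrow> (kelt \<Rightarrow> complex^'n^'n) \<Rightarrow> (complex^'n) set \<Rightarrow> bool" where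
  "wonderful_variety p q \<rho> X \<longleftrightarrow>
     rational_rep p q \<rho> \<and> irreducible_closed X \<and> stable_under \<rho> (grpK p q) X \<and> smooth_variety X \<and>
     (\<exists>x\<in>X. \<exists>\<D>. finite \<D> \<and> (\<forall>Z\<in>\<D>. prime_divisor X Z \<and> smooth_variety Z) \<and>
        orbit p q \<rho> x = X - \<Union>\<D> \<and> normal_crossings X \<D> \<and> X \<inter> \<Inter>\<D> \<noteq> {} \<and>
        (\<forall>y\<in>X. \<forall>z\<in>X. orbit p q \<rho> y = orbit p q \<rho> z \<longleftrightarrow> (\<forall>Z\<in>\<D>. y \<in> Z \<longleftrightarrow> z \<in> Z)))"

text \<open>The wonderful variety with open orbit \<open>K / N\<^sub>K(K\<^sub>e)\<close>; the point spanned by \<open>x0\<close> is the image of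
  the base point of \<open>K / N\<^sub>K(K\<^sub>e)\<close>.\<close>

definition wonderful_compactification_e ::
  "nat \<Rightarrow> nat \<Rightarrow> nat \<Rightarrow> nat \<Rightarrow> (kelt \<Rightarrow> complex^'n^'n) \<Rightarrow> (complex^'n) set \<Rightarrow> complex^'n \<Rightarrow> bool" where
  "wonderful_compactification_e p q r s \<rho> X x0 \<longleftrightarrow>
     wonderful_variety p q \<rho> X \<and> x0 \<in> X \<and> zariski_closed (X - orbit p q \<rho> x0) \<and>
     point_stabilizer p q \<rho> x0 = normalizerK p q (stabilizer_e p q r s)"


section \<open>Colors\<close>

definition colors ::
  "nat \<Rightarrow> nat \<Rightarrow> (kelt \<Rightarrow> complex^'n^'n) \<Rightarrow> (complex^'n) set \<Rightarrow> (complex^'n) set set" where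
  "colors p q \<rho> X = {Z. prime_divisor X Z \<and> stable_under \<rho> (borel p q) Z \<and>
                        \<not> stable_under \<rho> (grpK p q) Z}"

definition movers ::
  "nat \<Rightarrow> nat \<Rightarrow> (kelt \<Rightarrow> complex^'n^'n) \<Rightarrow> (complex^'n) set \<Rightarrow> simple_root set" where
  "movers p q \<rho> Z = {\<alpha> \<in> simple_roots p q.
     {\<rho> g *v x | g x. g \<in> min_parabolic p q \<alpha> \<and> x \<in> Z} \<noteq> Z}"

definition ZDelta ::
  "nat \<Rightarrow> nat \<Rightarrow> (kelt \<Rightarrow> complex^'n^'n) \<Rightarrow> (complex^'n) set \<Rightarrow> ((complex^'n) set \<Rightarrow>\<^sub>0 int) set" where
  "ZDelta p q \<rho> X = {E. Poly_Mapping.keys E \<subseteq> colors p q \<rho> X}"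

definition NDelta ::
  "nat \<Rightarrow> nat \<Rightarrow> (kelt \<Rightarrow> complex^'n^'n) \<Rightarrow> (complex^'n) set \<Rightarrow> ((complex^'n) set \<Rightarrow>\<^sub>0 int) set" where
  "NDelta p q \<rho> X = {E \<in> ZDelta p q \<rho> X. \<forall>Z. 0 \<le> Poly_Mapping.lookup E Z}"


section \<open>Spherical roots\<close>

definition base_point ::
  "nat \<Rightarrow> nat \<Rightarrow> (kelt \<Rightarrow> complex^'n^'n) \<Rightarrow> (complex^'n) set \<Rightarrow> complex^'n \<Rightarrow> bool" where
  "base_point p q \<rho> X y \<longleftrightarrow> y \<in> X \<and> zariski_closed (orbit p q \<rho> y) \<and>
     (\<forall>g\<in>opp_borel p q. \<exists>c. \<rho> g *v y = c *s y)"

text \<open>\<open>\<theta>\<close> is a weight of the torus on the quotient of the tangent spaces of \<open>X\<close> and \<open>Y\<close> at the point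
  spanned by \<open>y\<close>. If \<open>c\<close> is the eigenvalue of \<open>t\<close> on \<open>y\<close>, then passing from cone tangent vectors to
  tangent vectors of the projective variety divides weights by \<open>c\<close>.\<close>

definition normal_weight ::
  "nat \<Rightarrow> nat \<Rightarrow> (kelt \<Rightarrow> complex^'n^'n) \<Rightarrow> (complex^'n) set \<Rightarrow> (complex^'n) set \<Rightarrow> complex^'n \<Rightarrow>
   (kelt \<Rightarrow> complex) \<Rightarrow> bool" where
  "normal_weight p q \<rho> X Y y \<theta> \<longleftrightarrow> \<theta> \<in> extensional (torus p q) \<and>
     (\<exists>v \<in> cone_tangent X y - cone_tangent Y y. \<forall>t\<in>torus p q. \<exists>c.
        \<rho> t *v y = c *s y \<and> \<rho> t *v v - (\<theta> t * c) *s v \<in> cone_tangent Y y)"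

definition spherical_roots ::
  "nat \<Rightarrow> nat \<Rightarrow> (kelt \<Rightarrow> complex^'n^'n) \<Rightarrow> (complex^'n) set \<Rightarrow> (kelt \<Rightarrow> complex) set" where
  "spherical_roots p q \<rho> X =
     {\<theta>. \<exists>y. base_point p q \<rho> X y \<and> normal_weight p q \<rho> X (orbit p q \<rho> y) y \<theta>}"

text \<open>The \<open>K\<close>-stable prime divisor corresponding to a spherical root: the torus acts by that root on
  its normal line at the base point.\<close>

definition root_divisor ::
  "nat \<Rightarrow> nat \<Rightarrow> (kelt \<Rightarrow> complex^'n^'n) \<Rightarrow> (complex^'n) set \<Rightarrow> (kelt \<Rightarrow> complex) \<Rightarrow> (complex^'n) set" where
  "root_divisor p q \<rho> X \<theta> = (THE Z. prime_divisor X Z \<and> stable_under \<rho> (grpK p q) Z \<and>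
     (\<exists>y. base_point p q \<rho> X y \<and> normal_weight p q \<rho> X Z y \<theta>))"

text \<open>The image of a spherical root under \<open>\<int>\<Sigma> \<subseteq> Pic(X) = \<int>\<Delta>\<close>.\<close>

definition root_class ::
  "nat \<Rightarrow> nat \<Rightarrow> (kelt \<Rightarrow> complex^'n^'n) \<Rightarrow> (complex^'n) set \<Rightarrow> (kelt \<Rightarrow> complex) \<Rightarrow>
   ((complex^'n) set \<Rightarrow>\<^sub>0 int)" where
  "root_class p q \<rho> X \<theta> = (THE E. E \<in> ZDelta p q \<rho> X \<and>
     lin_equiv X (frag_of (root_divisor p q \<rho> X \<theta>)) E)"

definition NSigma ::
  "nat \<Rightarrow> nat \<Rightarrow> (kelt \<Rightarrow> complex^'n^'n) \<Rightarrow> (complex^'n) set \<Rightarrow> ((complex^'n) set \<Rightarrow>\<^sub>0 int) set" where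
  "NSigma p q \<rho> X = semigroup_gen (root_class p q \<rho> X ` spherical_roots p q \<rho> X)"

definition le_Sigma ::
  "nat \<Rightarrow> nat \<Rightarrow> (kelt \<Rightarrow> complex^'n^'n) \<Rightarrow> (complex^'n) set \<Rightarrow>
   ((complex^'n) set \<Rightarrow>\<^sub>0 int) \<Rightarrow> ((complex^'n) set \<Rightarrow>\<^sub>0 int) \<Rightarrow> bool" where
  "le_Sigma p q \<rho> X D E \<longleftrightarrow> E - D \<in> NSigma p q \<rho> X"


section \<open>The semigroup\<close>

text \<open>\<open>\<phi>\<close> is the equivariant morphism from \<open>X\<close> to the projective space of \<open>\<pp>\<^sub>k\<close> that sends the base
  point of the open orbit to the line spanned by the \<open>\<pp>\<^sub>k\<close>-component of \<open>e\<close>.\<close>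

definition extends_projection ::
  "nat \<Rightarrow> nat \<Rightarrow> nat \<Rightarrow> nat \<Rightarrow> (kelt \<Rightarrow> complex^'n^'n) \<Rightarrow> (complex^'n) set \<Rightarrow> complex^'n \<Rightarrow> nat \<Rightarrow>
   (complex^'n \<Rightarrow> complex mat) \<Rightarrow> bool" where
  "extends_projection p q r s \<rho> X x0 k \<phi> \<longleftrightarrow>
     proj_morphism (p_rows p q k) (p_cols p q k) X \<phi> \<and>
     (\<forall>g\<in>grpK p q. \<forall>x\<in>X. \<exists>c. c \<noteq> 0 \<and> \<phi> (\<rho> g *v x) = c \<cdot>\<^sub>m p_act k g (\<phi> x)) \<and>
     (\<exists>c. c \<noteq> 0 \<and> \<phi> x0 = c \<cdot>\<^sub>m e_comp p q r s k)"

definition D_p ::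
  "nat \<Rightarrow> nat \<Rightarrow> nat \<Rightarrow> nat \<Rightarrow> (kelt \<Rightarrow> complex^'n^'n) \<Rightarrow> (complex^'n) set \<Rightarrow> complex^'n \<Rightarrow> nat \<Rightarrow>
   ((complex^'n) set \<Rightarrow>\<^sub>0 int)" where
  "D_p p q r s \<rho> X x0 k = (THE E. E \<in> NDelta p q \<rho> X \<and>
     (\<exists>\<phi> H. extends_projection p q r s \<rho> X x0 k \<phi> \<and>
        hyperplane_pullback (p_rows p q k) (p_cols p q k) X \<phi> H \<and> lin_equiv X H E))"

definition Gamma_p ::
  "nat \<Rightarrow> nat \<Rightarrow> nat \<Rightarrow> nat \<Rightarrow> (kelt \<Rightarrow> complex^'n^'n) \<Rightarrow> (complex^'n) set \<Rightarrow> complex^'n \<Rightarrow>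
   (nat \<times> nat \<times> ((complex^'n) set \<Rightarrow>\<^sub>0 int)) set" where
  "Gamma_p p q r s \<rho> X x0 = {(n1, n2, E). E \<in> NDelta p q \<rho> X \<and>
     le_Sigma p q \<rho> X E (frag_cmul (int n1) (D_p p q r s \<rho> X x0 1) +
                          frag_cmul (int n2) (D_p p q r s \<rho> X x0 2))}"


section \<open>Labelling of spherical roots and colors\<close>

definition rk :: "nat \<Rightarrow> nat \<Rightarrow> nat \<Rightarrow> nat" where
  "rk r s k = (if k = 1 then r else s)"

text \<open>\<open>\<sigma>\<^bsup>k\<^esup>\<^sub>h\<close> for \<open>1 \<le> h \<le> 2 r\<^sub>k\<close>.\<close>

definition sigma :: "nat \<Rightarrow> nat \<Rightarrow> nat \<Rightarrow> nat \<Rightarrow> simple_root" where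
  "sigma p q k h =
     (if k = 1 then (if odd h then SRp (p - (h + 1) div 2) else SRq (h div 2))
               else (if odd h then SRp ((h + 1) div 2) else SRq (q - h div 2)))"

text \<open>The convention \<open>D\<^bsup>k\<^esup>\<^sub>h = D\<^bsup>3-k\<^esup>\<^sub>h'\<close> for \<open>h = 2 r\<^sub>k + 3\<close> and \<open>h' = 2 r\<^bsub>3-k\<^esub> + 1\<close>.\<close>

definition ext_color :: "nat \<Rightarrow> nat \<Rightarrow> (nat \<Rightarrow> nat \<Rightarrow> 'a) \<Rightarrow> nat \<Rightarrow> nat \<Rightarrow> 'a" where
  "ext_color r s D k h =
     (if h = 2 * rk r s k + 3 then D (3 - k) (2 * rk r s (3 - k) + 1) else D k h)"

definition Dtilde :: "nat \<Rightarrow> nat \<Rightarrow> (nat \<Rightarrow> nat \<Rightarrow> 'a) \<Rightarrow> nat \<Rightarrow> nat \<Rightarrow> ('a \<Rightarrow>\<^sub>0 int)" where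
  "Dtilde r s D k h =
     (if h = 0 then 0
      else if h < 2 * rk r s k + 1 then frag_of (ext_color r s D k h)
      else frag_of (ext_color r s D k h) + frag_of (ext_color r s D k (h + 1)))"

end

theory Submission
  imports Defs
begin

text \<open>
  With \<open>x h\<close> for \<open>Dtilde k h\<close>, \<open>R = rk k\<close> and \<open>d h = x h - x (h - 1)\<close>, the \<open>h\<close>-th spherical root
  of the chain \<open>k\<close> is \<open>d h - d (h + 2)\<close>, and the last differences \<open>d (2 * R + 2)\<close> of the two chains
  are opposite to each other. Hence \<open>i * x 2 - x (2 * i)\<close> is a sum of spherical roots, while
  \<open>i * x 2 - x (2 * i - 1)\<close> is one up to \<open>d (2 * R + 2)\<close>, so that odd elements have to come in
  pairs, one from each chain.

  Conversely, summation by parts writes an element \<open>E\<close> below \<open>n1 D\<^sub>1 + n2 D\<^sub>2\<close> as the sum, over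
  both chains, of the terms \<open>z h * x h\<close> with \<open>h \<le> 2 * R\<close>, of \<open>g * x (2 * R + 2)\<close> and of
  \<open>O * d (2 * R + 2)\<close>, where \<open>O\<close> is the sum of the \<open>z h\<close> with \<open>h\<close> odd. The coefficients of \<open>E\<close> at
  the colors are nonnegative iff all \<open>z h\<close> are and \<open>O \<le> O' + g'\<close>, \<open>O' \<le> O + g\<close>; these inequalities
  allow each odd element to be paired with an odd element or a last element of the other chain.
\<close>

section \<open>Generated semigroups and summation by parts\<close>

lemma semigroup_gen_base: "x \<in> S \<Longrightarrow> x \<in> semigroup_gen S"
  using semigroup_gen.add[OF _ semigroup_gen.zero, of x S] by simp

lemma semigroup_gen_plus:
  assumes "x \<in> semigroup_gen S" and "y \<in> semigroup_gen S"
  shows "x + y \<in> semigroup_gen S"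
  using assms by induction (auto simp: add.assoc intro: semigroup_gen.add)

lemma semigroup_gen_sum:
  assumes "\<And>i. i \<in> I \<Longrightarrow> f i \<in> semigroup_gen S"
  shows "sum f I \<in> semigroup_gen S"
  using assms
  by (induction I rule: infinite_finite_induct) (auto intro: semigroup_gen.zero semigroup_gen_plus)

lemma semigroup_gen_subset:
  assumes "S \<subseteq> M" and "0 \<in> M" and "\<And>x y. x \<in> M \<Longrightarrow> y \<in> M \<Longrightarrow> x + y \<in> M"
  shows "semigroup_gen S \<subseteq> M"
proof
  fix x assume "x \<in> semigroup_gen S"
  then show "x \<in> M" by induction (use assms in auto)
qed

lemma semigroup_gen_image_sum:
  fixes g :: "'b \<Rightarrow> 'a \<Rightarrow>\<^sub>0 int"
  assumes "finite I" and "x \<in> semigroup_gen (g ` I)"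
  obtains c :: "'b \<Rightarrow> nat" where "x = (\<Sum>i\<in>I. frag_cmul (int (c i)) (g i))"
proof -
  have "\<exists>c :: 'b \<Rightarrow> nat. x = (\<Sum>i\<in>I. frag_cmul (int (c i)) (g i))"
    using assms(2)
  proof induction
    case zero
    show ?case by (rule exI[of _ "\<lambda>_. 0"]) simp
  next
    case (add x y)
    from add.IH obtain c :: "'b \<Rightarrow> nat" where c: "y = (\<Sum>i\<in>I. frag_cmul (int (c i)) (g i))" by blast
    from add.hyps(1) obtain i where i: "i \<in> I" "x = g i" by blast
    have "(\<Sum>j\<in>I. frag_cmul (int ((c(i := Suc (c i))) j)) (g j))
        = frag_cmul (int (Suc (c i))) (g i) + (\<Sum>j\<in>I-{i}. frag_cmul (int (c j)) (g j))"
      using i(1) assms(1) by (simp add: sum.remove)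
    also have "\<dots> = x + y"
      using i assms(1) by (simp add: c sum.remove frag_cmul_distrib add.assoc)
    finally show ?case by metis
  qed
  then show ?thesis using that by blast
qed

lemma semigroup_gen_weighted_multiple:
  fixes v :: "'a \<Rightarrow>\<^sub>0 int"
  assumes "(m, k, v) \<in> semigroup_gen S"
  shows "(n * m, n * k, frag_cmul (int n) v) \<in> semigroup_gen (S :: (nat \<times> nat \<times> _) set)"
proof (induction n)
  case 0
  show ?case using semigroup_gen.zero[of S] by (simp add: zero_prod_def)
next
  case (Suc n)
  from semigroup_gen_plus[OF assms Suc] show ?case by (simp add: frag_cmul_distrib)
qed

text \<open>With \<open>d h = x h - x (h - 1)\<close>, the bracket is \<open>d h - d (h + 2)\<close>
  and \<open>n * x 2 = e 1 * d 1 + e 2 * d 2\<close>. Hence the left side is the sum of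
  \<open>(e h - e (h + 2)) * d h\<close> for \<open>h \<le> R\<close>, plus the boundary terms
  \<open>e (R + 1) * d (R + 1)\<close> and \<open>e (R + 2) * d (R + 2)\<close>; summation by parts
  then moves the difference from \<open>x\<close> to \<open>e\<close>.\<close>

lemma telescoped_chain:
  fixes x e :: "nat \<Rightarrow> int"
  assumes "x 0 = 0" and "e 1 = n" and "e 2 = n"
  shows "n * x 2 - (\<Sum>h=1..R. e (h + 2) * (- x (h - 1) + x h + x (h + 1) - x (h + 2)))
    = (\<Sum>h=1..R. (e h - e (h + 1) - e (h + 2) + e (h + 3)) * x h)
      + (e (R + 1) - e (R + 3)) * x R + e (R + 1) * (x (R + 1) - x R)
      + e (R + 2) * (x (R + 2) - x (R + 1))"
proof (induction R)
  case 0
  then show ?case using assms by (simp add: algebra_simps numeral_2_eq_2)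
next
  case (Suc R)
  then show ?case by (simp add: algebra_simps numeral_2_eq_2 numeral_3_eq_3)
qed

section \<open>Parity of indices along a chain\<close>

lemma sum_odd_even:
  fixes f :: "nat \<Rightarrow> 'a::comm_monoid_add"
  shows "(\<Sum>h=1..2 * r. f h) = (\<Sum>i=1..r. f (2 * i - 1)) + (\<Sum>i=1..r. f (2 * i))"
  by (induction r) (simp_all add: ac_simps)

text \<open>The triples \<open>(k, m, u)\<close> and \<open>(l, n, v)\<close> record number, total
  weight and sum of the odd elements taken from each chain. Pair an \<open>x i\<close> with a
  \<open>y j\<close> as long as both kinds remain. A surplus \<open>x i\<close> then takes a copy of
  \<open>b\<close> together with one \<open>\<delta>\<close>, a surplus \<open>y j\<close> a copy of
  \<open>a\<close> together with one \<open>- \<delta>\<close>, which accounts for the coefficient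
  \<open>k - l\<close>. The two inequalities guarantee enough copies of \<open>b\<close> and
  \<open>a\<close>; copies left over are themselves in the semigroup.\<close>

lemma odd_pairing:
  fixes \<delta> a b :: "'a \<Rightarrow>\<^sub>0 int" and x y :: "nat \<Rightarrow> 'a \<Rightarrow>\<^sub>0 int"
  assumes a: "(R, 0, a) \<in> semigroup_gen G" and b: "(0, S, b) \<in> semigroup_gen G"
    and xy: "\<And>i j. i \<in> I \<Longrightarrow> j \<in> J \<Longrightarrow> (i, j, x i + y j) \<in> semigroup_gen G"
    and ay: "\<And>j. j \<in> J \<Longrightarrow> (R, j, a - \<delta> + y j) \<in> semigroup_gen G"
    and xb: "\<And>i. i \<in> I \<Longrightarrow> (i, S, x i + (b + \<delta>)) \<in> semigroup_gen G"
    and 1: "(k, m, u) \<in> semigroup_gen {(1, i, x i) | i. i \<in> I}"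
    and 2: "(l, n, v) \<in> semigroup_gen {(1, j, y j) | j. j \<in> J}"
    and "k \<le> l + w" and "l \<le> k + z"
  shows "(m + z * R, n + w * S,
      u + v + frag_cmul (int z) a + frag_cmul (int w) b + frag_cmul (int k - int l) \<delta>)
    \<in> semigroup_gen G"
proof -
  define X where "X = {(1::nat, i, x i) | i. i \<in> I}"
  define Y where "Y = {(1::nat, j, y j) | j. j \<in> J}"
  define T where "T z w m n u v d = (m + z * R, n + w * S,
      u + v + frag_cmul (int z) a + frag_cmul (int w) b + frag_cmul d \<delta>)"
    for z w m n :: nat and u v and d :: int
  have T0: "T z w 0 0 0 0 0 \<in> semigroup_gen G" for z w
    using semigroup_gen_plus[OF semigroup_gen_weighted_multiple[OF a, of z]
      semigroup_gen_weighted_multiple[OF b, of w]] by (simp add: T_def)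
  \<comment> \<open>Nothing is left in the second chain: every odd element of the first one consumes
    a copy of \<open>b\<close>.\<close>
  have T1: "T z w m 0 u 0 (int k) \<in> semigroup_gen G"
    if "(k, m, u) \<in> semigroup_gen X" "k \<le> w" for k m u z w
  proof -
    have "case t of (k, m, u) \<Rightarrow> \<forall>w \<ge> k. T z w m 0 u 0 (int k) \<in> semigroup_gen G"
      if "t \<in> semigroup_gen X" for t
      using that
    proof induction
      case zero
      then show ?case using T0 by (simp add: zero_prod_def)
    next
      case (add s t)
      obtain k m u where t: "t = (k, m, u)" by (cases t)
      from add.hyps(1) obtain i where i: "i \<in> I" "s = (1, i, x i)" by (auto simp: X_def)
      show ?case
      proof (simp add: t i, intro allI impI)
        fix w assume w: "Suc k \<le> w"
        then obtain w' where w': "w = Suc w'" "k \<le> w'" by (cases w) auto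
        with add.IH t have "T z w' m 0 u 0 (int k) \<in> semigroup_gen G" by auto
        from semigroup_gen_plus[OF xb[OF i(1)] this]
        show "T z w (i + m) 0 (x i + u) 0 (1 + int k) \<in> semigroup_gen G"
          by (simp add: T_def w' frag_cmul_distrib algebra_simps)
      qed
    qed
    from this[OF that(1)] that(2) show ?thesis by auto
  qed
  \<comment> \<open>Induction on the second chain with the first chain universally quantified,
    because each step may also remove one of its elements.\<close>
  have T2: "case t of (l, n, v) \<Rightarrow> \<forall>k m u z w. (k, m, u) \<in> semigroup_gen X \<longrightarrow> k \<le> l + w \<longrightarrow>
      l \<le> k + z \<longrightarrow> T z w m n u v (int k - int l) \<in> semigroup_gen G"
    if "t \<in> semigroup_gen Y" for t
    using that
  proof induction
    case zero
    then show ?case using T1 by (simp add: zero_prod_def)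
  next
    case (add s t)
    obtain l n v where t: "t = (l, n, v)" by (cases t)
    from add.hyps(1) obtain j where j: "j \<in> J" "s = (1, j, y j)" by (auto simp: Y_def)
    note IH = add.IH[unfolded t prod.case, rule_format]
    show ?case
    proof (simp add: t j, intro allI impI)
      fix k m u z w
      assume k: "(k, m, u) \<in> semigroup_gen X" and kl: "k \<le> Suc (l + w)" and lk: "Suc l \<le> k + z"
      \<comment> \<open>The new \<open>y j\<close> is paired with an odd element of the first chain
        if there is one; otherwise \<open>k = 0\<close>, the inequality forces \<open>z > 0\<close>,
        and a copy of \<open>a\<close> is consumed.\<close>
      from k show "T z w m (j + n) u (y j + v) (int k - (1 + int l)) \<in> semigroup_gen G"
      proof cases
        case zero
        then have z: "k = 0" "m = 0" "u = 0" by (simp_all add: zero_prod_def)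
        with lk obtain z' where z': "z = Suc z'" "l \<le> z'" by (cases z) auto
        have "T z' w 0 n 0 v (int 0 - int l) \<in> semigroup_gen G"
          using z' by (intro IH) (auto simp: z semigroup_gen.zero simp flip: zero_prod_def)
        from semigroup_gen_plus[OF ay[OF j(1)] this] show ?thesis
          by (simp add: T_def z z' frag_cmul_distrib frag_cmul_diff_distrib algebra_simps
              del: minus_frag_cmul flip: minus_frag_cmul)
      next
        case (add s' t')
        obtain k' m' u' where t': "t' = (k', m', u')" by (cases t')
        from add(2) obtain i where i: "i \<in> I" "s' = (1, i, x i)" by (auto simp: X_def)
        have eq: "k = Suc k'" "m = i + m'" "u = x i + u'" using add(1) by (auto simp: t' i)
        have "T z w m' n u' v (int k' - int l) \<in> semigroup_gen G"
          using add(3) kl lk by (intro IH) (auto simp: t' eq)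
        from semigroup_gen_plus[OF xy[OF i(1) j(1)] this] show ?thesis
          by (simp add: T_def eq algebra_simps)
      qed
    qed
  qed
  show ?thesis
    using T2[of "(l, n, v)"] assms(6-9) by (auto simp: X_def Y_def T_def)
qed


text \<open>The integers \<open>z h\<close> may still be negative; positivity enters only through
  the coefficients at the colors. The second conclusion is conservation of weight, where
  \<open>x (2 * i - 1)\<close> and \<open>x (2 * i)\<close> both have weight
  \<open>i\<close>.\<close>

lemma chain_normal_form:
  fixes x :: "nat \<Rightarrow> 'a \<Rightarrow>\<^sub>0 int" and c :: "nat \<Rightarrow> nat"
  assumes x0: "x 0 = 0"
  obtains z :: "nat \<Rightarrow> int" and g :: nat where
    "frag_cmul (int n) (x 2)
        - (\<Sum>h=1..2 * R. frag_cmul (int (c h)) (- x (h - 1) + x h + x (h + 1) - x (h + 2)))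
      = (\<Sum>h=1..2 * R. frag_cmul (z h) (x h)) + frag_cmul (int g) (x (2 * R + 2))
        + frag_cmul (\<Sum>i=1..R. z (2 * i - 1)) (x (2 * R + 2) - x (2 * R + 1))"
    and "int n = (\<Sum>i=1..R. z (2 * i - 1) * int i) + (\<Sum>i=1..R. z (2 * i) * int i)
        + int g * int (R + 1)"
proof -
  \<comment> \<open>The two leading values \<open>n\<close> encode \<open>n * x 2\<close>, the root
    coefficients follow with a shift by two, and the zeros beyond make the boundary value
    \<open>e (2 * R + 3)\<close> vanish.\<close>
  define e where "e h = (if h \<le> 2 then int n else if h \<le> 2 * R + 2 then int (c (h - 2)) else 0)" for h
  define z where "z h = e h - e (h + 1) - e (h + 2) + e (h + 3)" for h
  \<comment> \<open>The boundary terms add up to \<open>e (2 * R + 1) * x (2 * R + 1) + e (2 * R +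
    2) * d (2 * R + 2)\<close>, where \<open>d h = x h - x (h - 1)\<close>. Replacing
    \<open>x (2 * R + 1)\<close> by \<open>x (2 * R + 2) - d (2 * R + 2)\<close> produces
    \<open>g\<close> and \<open>O'\<close>.\<close>
  define g where "g = nat (e (2 * R + 1))"
  define O' where "O' = e (2 * R + 2) - e (2 * R + 1)"
  have g: "int g = e (2 * R + 1)" by (simp add: g_def e_def)
  have ec: "e (h + 2) = int (c h)" if "h \<in> {1..2 * R}" for h using that by (auto simp: e_def)
  \<comment> \<open>The identity is kept for an arbitrary integer sequence \<open>y\<close>: it
    serves both for numerical test sequences and for each coefficient of \<open>x\<close>.\<close>
  have key: "int n * y 2 - (\<Sum>h=1..2 * R. int (c h) * (- y (h - 1) + y h + y (h + 1) - y (h + 2)))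
    = (\<Sum>h=1..2 * R. z h * y h) + int g * y (2 * R + 2) + O' * (y (2 * R + 2) - y (2 * R + 1))"
    if "y 0 = 0" for y :: "nat \<Rightarrow> int"
  proof -
    have "e 1 = int n" "e 2 = int n" "e (2 * R + 3) = 0" by (simp_all add: e_def)
    note telescoped_chain[of y e "int n" "2 * R", OF that this(1,2), unfolded this(3)]
    also have "(\<Sum>h=1..2 * R. e (h + 2) * (- y (h - 1) + y h + y (h + 1) - y (h + 2)))
        = (\<Sum>h=1..2 * R. int (c h) * (- y (h - 1) + y h + y (h + 1) - y (h + 2)))"
      by (intro sum.cong refl) (simp only: ec)
    finally show ?thesis
      unfolding z_def[symmetric] g O'_def by (simp add: algebra_simps)
  qed
  txt \<open>Specialising \<open>y\<close> to \<open>h mod 2\<close> and to \<open>(h + 1) div 2\<close>, both annihilated by the roots, computes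
    \<open>O'\<close> and \<open>n\<close>.\<close>
  have "(\<Sum>h=1..2 * R. z h * int (h mod 2)) = O'"
  proof -
    have "- int ((h - 1) mod 2) + int (h mod 2) + int ((h + 1) mod 2) - int ((h + 2) mod 2) = 0"
      if "h \<in> {1..2 * R}" for h
      using that by (cases h) (auto simp: mod_Suc)
    then have "(\<Sum>h=1..2 * R. int (c h) * (- int ((h - 1) mod 2) + int (h mod 2)
        + int ((h + 1) mod 2) - int ((h + 2) mod 2))) = 0"
      by (intro sum.neutral) simp
    with key[of "\<lambda>h. int (h mod 2)"] show ?thesis by simp
  qed
  moreover have "(\<Sum>i=1..R. z (2 * i - 1) * int ((2 * i - 1) mod 2)) = (\<Sum>i=1..R. z (2 * i - 1))"
  proof (intro sum.cong refl)
    fix i assume "i \<in> {1..R}"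
    then show "z (2 * i - 1) * int ((2 * i - 1) mod 2) = z (2 * i - 1)" by (cases i) auto
  qed
  ultimately have O': "O' = (\<Sum>i=1..R. z (2 * i - 1))"
    unfolding sum_odd_even by simp
  have "int n = (\<Sum>h=1..2 * R. z h * int ((h + 1) div 2)) + int g * int (R + 1)"
  proof -
    have "- int ((h - 1 + 1) div 2) + int ((h + 1) div 2) + int ((h + 1 + 1) div 2)
        - int ((h + 2 + 1) div 2) = 0"
      if "h \<in> {1..2 * R}" for h
      using that by (cases h) auto
    then have "(\<Sum>h=1..2 * R. int (c h) * (- int ((h - 1 + 1) div 2) + int ((h + 1) div 2)
        + int ((h + 1 + 1) div 2) - int ((h + 2 + 1) div 2))) = 0"
      by (intro sum.neutral) simp
    with key[of "\<lambda>h. int ((h + 1) div 2)"] show ?thesis by simp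
  qed
  then have n: "int n = (\<Sum>i=1..R. z (2 * i - 1) * int i) + (\<Sum>i=1..R. z (2 * i) * int i)
        + int g * int (R + 1)"
  proof -
    have "(\<Sum>i=1..R. z (2 * i - 1) * int ((2 * i - 1 + 1) div 2)) = (\<Sum>i=1..R. z (2 * i - 1) * int i)"
      by (intro sum.cong refl) simp
    moreover have "(\<Sum>i=1..R. z (2 * i) * int ((2 * i + 1) div 2)) = (\<Sum>i=1..R. z (2 * i) * int i)"
      by (intro sum.cong refl) simp
    ultimately show ?thesis
      using \<open>int n = _\<close> unfolding sum_odd_even by simp
  qed
  show ?thesis
  proof (rule that[OF _ n], unfold O'[symmetric], rule poly_mapping_eqI)
    fix t
    show "Poly_Mapping.lookup (frag_cmul (int n) (x 2)
        - (\<Sum>h=1..2 * R. frag_cmul (int (c h)) (- x (h - 1) + x h + x (h + 1) - x (h + 2)))) t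
      = Poly_Mapping.lookup ((\<Sum>h=1..2 * R. frag_cmul (z h) (x h)) + frag_cmul (int g) (x (2 * R + 2))
        + frag_cmul O' (x (2 * R + 2) - x (2 * R + 1))) t"
      using key[of "\<lambda>h. Poly_Mapping.lookup (x h) t"] x0 by (simp add: lookup_add lookup_minus lookup_sum)
  qed
qed

text \<open>Everything is a sum of differences \<open>d h - d (h + 2 * j)\<close> with
  \<open>d h = x h - x (h - 1)\<close>, each of which telescopes into the roots at \<open>h\<close>,
  \<open>h + 2\<close>, and so on.\<close>

lemma chain_closure:
  fixes x :: "nat \<Rightarrow> 'a \<Rightarrow>\<^sub>0 int"
  assumes x0: "x 0 = 0"
    and \<sigma>: "\<And>h. h \<in> {1..2 * R} \<Longrightarrow> - x (h - 1) + x h + x (h + 1) - x (h + 2) \<in> semigroup_gen M"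
  shows even_chain_closure: "i \<le> R + 1 \<Longrightarrow> frag_cmul (int i) (x 2) - x (2 * i) \<in> semigroup_gen M"
    and odd_chain_closure: "1 \<le> i \<Longrightarrow> i \<le> R + 1 \<Longrightarrow>
      frag_cmul (int i) (x 2) - x (2 * i - 1) - (x (2 * R + 2) - x (2 * R + 1)) \<in> semigroup_gen M"
proof -
  have step: "(x h - x (h - 1)) - (x (h + 2 * j) - x (h + 2 * j - 1)) \<in> semigroup_gen M"
    if "1 \<le> h" "h + 2 * j \<le> 2 * R + 2" for h j
    using that
  proof (induction j)
    case 0
    show ?case by (simp add: semigroup_gen.zero)
  next
    case (Suc j)
    then have "h + 2 * j \<in> {1..2 * R}" by auto
    from semigroup_gen_plus[OF Suc.IH \<sigma>[OF this]] Suc.prems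
    show ?case by (simp add: algebra_simps numeral_2_eq_2)
  qed
  show even: "frag_cmul (int i) (x 2) - x (2 * i) \<in> semigroup_gen M" if "i \<le> R + 1" for i
    using that
  proof (induction i)
    case 0
    show ?case by (simp add: x0 semigroup_gen.zero)
  next
    case (Suc i)
    then have "frag_cmul (int i) (x 2) - x (2 * i) \<in> semigroup_gen M" by simp
    \<comment> \<open>Passing from \<open>i\<close> to \<open>i + 1\<close> adds
      \<open>d 1 - d (2 * i + 1)\<close> and \<open>d 2 - d (2 * i + 2)\<close>.\<close>
    from semigroup_gen_plus[OF semigroup_gen_plus[OF this step[of 1 i]] step[of 2 i]] Suc.prems
    show ?case by (simp add: x0 frag_cmul_distrib algebra_simps)
  qed
  show "frag_cmul (int i) (x 2) - x (2 * i - 1) - (x (2 * R + 2) - x (2 * R + 1)) \<in> semigroup_gen M"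
    if "1 \<le> i" "i \<le> R + 1"
  proof -
    have "2 * i + 2 * (R + 1 - i) = 2 * R + 2" using that by simp
    \<comment> \<open>Replacing \<open>x (2 * i)\<close> by \<open>x (2 * i - 1)\<close> adds
      \<open>d (2 * i)\<close>, which is compared with the last difference of the same
      parity.\<close>
    with semigroup_gen_plus[OF even[OF that(2)] step[of "2 * i" "R + 1 - i"]] that
    show ?thesis by (simp add: algebra_simps)
  qed
qed

section \<open>Decomposition over both chains\<close>

lemma weighted_sum_in_semigroup_gen:
  fixes x :: "nat \<Rightarrow> 'a \<Rightarrow>\<^sub>0 int" and G :: "(nat \<times> nat \<times> ('a \<Rightarrow>\<^sub>0 int)) set"
  assumes "\<And>i. i \<in> I \<Longrightarrow> (m i, k i, x i) \<in> semigroup_gen G"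
  shows "(\<Sum>i\<in>I. c i * m i, \<Sum>i\<in>I. c i * k i, \<Sum>i\<in>I. frag_cmul (int (c i)) (x i)) \<in> semigroup_gen G"
  using semigroup_gen_sum[OF semigroup_gen_weighted_multiple[OF assms], of I "\<lambda>i. i" c]
  by (simp add: sum_prod)

text \<open>Terms of even index are multiples of generators. Those of odd index go to
  \<open>odd_pairing\<close>, together with \<open>a\<close> and \<open>b\<close> copies of the last
  elements and the multiples of the last differences.\<close>

lemma two_chains_decomposition:
  fixes x y :: "nat \<Rightarrow> 'a \<Rightarrow>\<^sub>0 int" and z w :: "nat \<Rightarrow> int"
  assumes x: "\<And>i. i \<in> {1..R + 1} \<Longrightarrow> (i, 0, x (2 * i)) \<in> semigroup_gen G"
    and y: "\<And>j. j \<in> {1..S + 1} \<Longrightarrow> (0, j, y (2 * j)) \<in> semigroup_gen G"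
    and xy: "\<And>i j. i \<in> {1..R + 1} \<Longrightarrow> j \<in> {1..S + 1} \<Longrightarrow> i + j < R + S + 2 \<Longrightarrow>
      (i, j, x (2 * i - 1) + y (2 * j - 1)) \<in> semigroup_gen G"
    and \<delta>: "y (2 * S + 2) - y (2 * S + 1) = - (x (2 * R + 2) - x (2 * R + 1))"
    and z: "\<And>h. h \<in> {1..2 * R} \<Longrightarrow> 0 \<le> z h" and w: "\<And>h. h \<in> {1..2 * S} \<Longrightarrow> 0 \<le> w h"
    and le1: "(\<Sum>i=1..R. z (2 * i - 1)) \<le> (\<Sum>j=1..S. w (2 * j - 1)) + int b"
    and le2: "(\<Sum>j=1..S. w (2 * j - 1)) \<le> (\<Sum>i=1..R. z (2 * i - 1)) + int a"
    and m: "int m = (\<Sum>i=1..R. z (2 * i - 1) * int i) + (\<Sum>i=1..R. z (2 * i) * int i)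
        + int a * int (R + 1)"
    and n: "int n = (\<Sum>j=1..S. w (2 * j - 1) * int j) + (\<Sum>j=1..S. w (2 * j) * int j)
        + int b * int (S + 1)"
    and E: "E = ((\<Sum>h=1..2 * R. frag_cmul (z h) (x h)) + frag_cmul (int a) (x (2 * R + 2))
        + frag_cmul (\<Sum>i=1..R. z (2 * i - 1)) (x (2 * R + 2) - x (2 * R + 1)))
      + ((\<Sum>h=1..2 * S. frag_cmul (w h) (y h)) + frag_cmul (int b) (y (2 * S + 2))
        + frag_cmul (\<Sum>j=1..S. w (2 * j - 1)) (y (2 * S + 2) - y (2 * S + 1)))"
  shows "(m, n, E) \<in> semigroup_gen G"
proof -
  define d where "d = x (2 * R + 2) - x (2 * R + 1)"
  define z' w' where "z' h = nat (z h)" and "w' h = nat (w h)" for h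
  have zn: "int (z' (2 * i)) = z (2 * i)" "int (z' (2 * i - Suc 0)) = z (2 * i - Suc 0)"
    if "i \<in> {1..R}" for i using that by (auto simp: z'_def intro!: z)
  have wn: "int (w' (2 * i)) = w (2 * i)" "int (w' (2 * i - Suc 0)) = w (2 * i - Suc 0)"
    if "i \<in> {1..S}" for i using that by (auto simp: w'_def intro!: w)
  have even1: "(\<Sum>i=1..R. z' (2 * i) * i, 0, \<Sum>i=1..R. frag_cmul (z (2 * i)) (x (2 * i)))
      \<in> semigroup_gen G"
    using weighted_sum_in_semigroup_gen[of "{1..R}" "\<lambda>i. i" "\<lambda>_. 0" "\<lambda>i. x (2 * i)" G "\<lambda>i. z' (2 * i)"] x
    by (simp add: zn cong: sum.cong_simp)
  have even2: "(0, \<Sum>j=1..S. w' (2 * j) * j, \<Sum>j=1..S. frag_cmul (w (2 * j)) (y (2 * j)))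
      \<in> semigroup_gen G"
    using weighted_sum_in_semigroup_gen[of "{1..S}" "\<lambda>_. 0" "\<lambda>j. j" "\<lambda>j. y (2 * j)" G "\<lambda>j. w' (2 * j)"] y
    by (simp add: wn cong: sum.cong_simp)
  have odd1: "(\<Sum>i=1..R. z' (2 * i - 1), \<Sum>i=1..R. z' (2 * i - 1) * i,
      \<Sum>i=1..R. frag_cmul (z (2 * i - 1)) (x (2 * i - 1)))
      \<in> semigroup_gen {(1, i, x (2 * i - 1)) | i. i \<in> {1..R}}" (is "_ \<in> semigroup_gen ?X")
    using weighted_sum_in_semigroup_gen[of "{1..R}" "\<lambda>_. 1" "\<lambda>i. i" "\<lambda>i. x (2 * i - 1)"
      ?X "\<lambda>i. z' (2 * i - 1)"]
    by (simp add: semigroup_gen_base zn cong: sum.cong_simp)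
  have odd2: "(\<Sum>j=1..S. w' (2 * j - 1), \<Sum>j=1..S. w' (2 * j - 1) * j,
      \<Sum>j=1..S. frag_cmul (w (2 * j - 1)) (y (2 * j - 1)))
      \<in> semigroup_gen {(1, j, y (2 * j - 1)) | j. j \<in> {1..S}}" (is "_ \<in> semigroup_gen ?Y")
    using weighted_sum_in_semigroup_gen[of "{1..S}" "\<lambda>_. 1" "\<lambda>j. j" "\<lambda>j. y (2 * j - 1)"
      ?Y "\<lambda>j. w' (2 * j - 1)"]
    by (simp add: semigroup_gen_base wn cong: sum.cong_simp)
  have Oz: "int (\<Sum>i=1..R. z' (2 * i - 1)) = (\<Sum>i=1..R. z (2 * i - 1))"
    by (simp add: zn cong: sum.cong_simp)
  have Ow: "int (\<Sum>j=1..S. w' (2 * j - 1)) = (\<Sum>j=1..S. w (2 * j - 1))"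
    by (simp add: wn cong: sum.cong_simp)
  have "((\<Sum>i=1..R. z' (2 * i - 1) * i) + a * (R + 1),
      (\<Sum>j=1..S. w' (2 * j - 1) * j) + b * (S + 1),
      (\<Sum>i=1..R. frag_cmul (z (2 * i - 1)) (x (2 * i - 1)))
      + (\<Sum>j=1..S. frag_cmul (w (2 * j - 1)) (y (2 * j - 1)))
      + frag_cmul (int a) (x (2 * R + 2)) + frag_cmul (int b) (y (2 * S + 2))
      + frag_cmul ((\<Sum>i=1..R. z (2 * i - 1)) - (\<Sum>j=1..S. w (2 * j - 1))) d)
    \<in> semigroup_gen G" (is "?odd \<in> _")
    unfolding Oz[symmetric] Ow[symmetric]
  \<comment> \<open>The pairing index sets stop at \<open>R\<close> and \<open>S\<close>.
    Subtracting \<open>d\<close> from \<open>x (2 * R + 2)\<close> gives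
    \<open>x (2 * R + 1)\<close>, and adding it to \<open>y (2 * S + 2)\<close> gives
    \<open>y (2 * S + 1)\<close>; so at most one member of a pair is the last odd element of its
    chain, as \<open>i + j < R + S + 2\<close> demands.\<close>
  proof (rule odd_pairing[OF _ _ _ _ _ odd1 odd2])
    show "(R + 1, 0, x (2 * R + 2)) \<in> semigroup_gen G" using x[of "R + 1"] by simp
    show "(0, S + 1, y (2 * S + 2)) \<in> semigroup_gen G" using y[of "S + 1"] by simp
    show "(i, j, x (2 * i - 1) + y (2 * j - 1)) \<in> semigroup_gen G"
      if "i \<in> {1..R}" "j \<in> {1..S}" for i j using that by (intro xy) auto
    show "(R + 1, j, x (2 * R + 2) - d + y (2 * j - 1)) \<in> semigroup_gen G"
      if "j \<in> {1..S}" for j using that xy[of "R + 1" j] by (simp add: d_def)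
    have "y (2 * S + 2) + d = y (2 * S + 1)" using \<delta> by (simp add: d_def algebra_simps)
    then show "(i, S + 1, x (2 * i - 1) + (y (2 * S + 2) + d)) \<in> semigroup_gen G"
      if "i \<in> {1..R}" for i using that xy[of i "S + 1"] by simp
  qed (use le1 le2 Oz Ow in linarith)+
  note semigroup_gen_plus[OF semigroup_gen_plus[OF even1 even2] this]
  moreover have "m = (\<Sum>i=1..R. z' (2 * i) * i) + ((\<Sum>i=1..R. z' (2 * i - 1) * i) + a * (R + 1))"
    unfolding of_nat_eq_iff[where 'a = int, symmetric] m
    by (simp add: zn cong: sum.cong_simp) (simp add: algebra_simps)
  moreover have "n = (\<Sum>j=1..S. w' (2 * j) * j) + ((\<Sum>j=1..S. w' (2 * j - 1) * j) + b * (S + 1))"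
    unfolding of_nat_eq_iff[where 'a = int, symmetric] n
    by (simp add: wn cong: sum.cong_simp) (simp add: algebra_simps)
  \<comment> \<open>Regrouping by parity; the last differences being opposite, their coefficients
    are subtracted.\<close>
  moreover have "E = (\<Sum>i=1..R. frag_cmul (z (2 * i)) (x (2 * i)))
      + (\<Sum>j=1..S. frag_cmul (w (2 * j)) (y (2 * j)))
      + ((\<Sum>i=1..R. frag_cmul (z (2 * i - 1)) (x (2 * i - 1)))
      + (\<Sum>j=1..S. frag_cmul (w (2 * j - 1)) (y (2 * j - 1)))
      + frag_cmul (int a) (x (2 * R + 2)) + frag_cmul (int b) (y (2 * S + 2))
      + frag_cmul ((\<Sum>i=1..R. z (2 * i - 1)) - (\<Sum>j=1..S. w (2 * j - 1))) d)"
  proof -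
    have "frag_cmul c (- d) = - frag_cmul c d" for c
      by (rule poly_mapping_eqI) (simp del: minus_frag_cmul)
    then show ?thesis
      unfolding E \<delta> d_def[symmetric] sum_odd_even frag_cmul_diff_distrib
      by (simp only: add_ac diff_conv_add_uminus)
  qed
  ultimately show ?thesis by (simp only: add_Pair add_0_left add_0_right)
qed

section \<open>Labels of simple roots and colors\<close>

lemma Collect_pair_image: "{f k h | k h. k \<in> A \<and> h \<in> B k} = (\<lambda>(k, h). f k h) ` Sigma A B"
  by auto

text \<open>The first chain takes the last \<open>r\<close> simple roots of GL(p) and the first
  \<open>r\<close> of GL(q), the second chain the first \<open>s\<close> and the last
  \<open>s\<close>. The rank bounds keep these segments disjoint.\<close>

lemma sigma_inj:
  assumes "sigma p q k h = sigma p q k' h'" and "k \<in> {1, 2}" "k' \<in> {1, 2}"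
    and "h \<in> {1..2 * rk r s k}" "h' \<in> {1..2 * rk r s k'}"
    and "r + s < q" and "r + s + 1 < p"
  shows "k = k' \<and> h = h'"
  using assms unfolding sigma_def rk_def by (auto split: if_splits elim!: oddE evenE)

lemma sigma_neq_SRp:
  assumes "k \<in> {1, 2}" and "h \<in> {1..2 * rk r s k}" and "s < i" and "i + r < p"
  shows "sigma p q k h \<noteq> SRp i"
  using assms unfolding sigma_def rk_def by (auto split: if_splits elim!: oddE evenE)

text \<open>These are the index sets of the roots moving the colors of a chain with \<open>N\<close>
  roots. If \<open>i < j\<close> have the same set, then \<open>i\<close> lies in it, so
  \<open>j = i + 1\<close>; now \<open>j\<close> separates the sets, or \<open>i - 1\<close> does
  when \<open>j = N + 1\<close>. For \<open>N = 1\<close> both indices would give the set of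
  \<open>1\<close> alone.\<close>

lemma consecutive_pair_inj:
  fixes h h' N :: nat
  assumes "{h - 1, h} \<inter> {1..N} = {h' - 1, h'} \<inter> {1..N}" and "2 \<le> N"
    and "h \<in> {1..N + 1}" and "h' \<in> {1..N + 1}"
  shows "h = h'"
proof -
  have "\<not> i < j" if eq: "{i - 1, i} \<inter> {1..N} = {j - 1, j} \<inter> {1..N}" and ij: "1 \<le> i" "j \<le> N + 1" for i j
  proof
    assume "i < j"
    have iff: "(x = i - 1 \<or> x = i) \<longleftrightarrow> (x = j - 1 \<or> x = j)" if "1 \<le> x" "x \<le> N" for x
      using eq that by (simp add: set_eq_iff) blast
    have "j = i + 1" using iff[of i] \<open>i < j\<close> ij by auto
    then show False
      using iff[of j] iff[of "i - 1"] ij \<open>2 \<le> N\<close> by (cases "j = N + 1"; auto; arith)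
  qed
  from this[OF assms(1)] this[OF assms(1)[symmetric]] assms(3,4) show ?thesis
    by (metis atLeastAtMost_iff linorder_neqE_nat)
qed

theorem proposition4p9:
  fixes p q r s :: nat
    and \<rho> :: "kelt \<Rightarrow> complex^'n^'n"
    and X :: "(complex^'n) set"
    and x0 :: "complex^'n"
    and D :: "nat \<Rightarrow> nat \<Rightarrow> (complex^'n) set"
  assumes "0 < r" and "0 < s" and "r + s = q - 1" and "r + s \<le> p - 2"
    and wonderful: "wonderful_compactification_e p q r s \<rho> X x0"
    and Sigma: "spherical_roots p q \<rho> X =
        {root_char p q (sigma p q k h) | k h. k \<in> {1, 2} \<and> h \<in> {1..2 * rk r s k}}"
    and Delta: "colors p q \<rho> X = {D k h | k h. k \<in> {1, 2} \<and> h \<in> {1..2 * rk r s k + 2}}"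
    and first_color: "\<And>k E. k \<in> {1, 2} \<Longrightarrow> E \<in> colors p q \<rho> X \<Longrightarrow>
        movers p q \<rho> E = {sigma p q k 1} \<longleftrightarrow> E = D k 1"
    and middle_color: "\<And>k h E. k \<in> {1, 2} \<Longrightarrow> h \<in> {2..2 * rk r s k} \<Longrightarrow> E \<in> colors p q \<rho> X \<Longrightarrow>
        movers p q \<rho> E = {sigma p q k (h - 1), sigma p q k h} \<longleftrightarrow> E = D k h"
    and last_color: "\<And>k E. k \<in> {1, 2} \<Longrightarrow> E \<in> colors p q \<rho> X \<Longrightarrow>
        movers p q \<rho> E = {sigma p q k (2 * rk r s k)} \<longleftrightarrow> E = D k (2 * rk r s k + 1)"
    and extra_color_1: "\<And>E. E \<in> colors p q \<rho> X \<Longrightarrow>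
        SRp (p - r - 1) \<in> movers p q \<rho> E \<longleftrightarrow> E = D 1 (2 * r + 2)"
    and extra_color_2: "\<And>E. E \<in> colors p q \<rho> X \<Longrightarrow>
        SRp (s + 1) \<in> movers p q \<rho> E \<longleftrightarrow> E = D 2 (2 * s + 2)"
    and coincidence: "D 1 (2 * r + 2) = D 2 (2 * s + 2) \<longleftrightarrow> p = q + 1"
    and root_expansion: "\<And>k h. k \<in> {1, 2} \<Longrightarrow> h \<in> {1..2 * rk r s k} \<Longrightarrow>
        root_class p q \<rho> X (root_char p q (sigma p q k h)) =
          - Dtilde r s D k (h - 1) + Dtilde r s D k h
          + Dtilde r s D k (h + 1) - Dtilde r s D k (h + 2)"
    and D_p1: "D_p p q r s \<rho> X x0 1 = frag_of (D 1 2)"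
    and D_p2: "D_p p q r s \<rho> X x0 2 = frag_of (D 2 2)"
  shows "Gamma_p p q r s \<rho> X x0 =
    semigroup_gen
      ({(i, 0, Dtilde r s D 1 (2 * i)) | i. i \<in> {1..r + 1}} \<union>
       {(0, j, Dtilde r s D 2 (2 * j)) | j. j \<in> {1..s + 1}} \<union>
       {(i, j, Dtilde r s D 1 (2 * i - 1) + Dtilde r s D 2 (2 * j - 1)) | i j.
          i \<in> {1..r + 1} \<and> j \<in> {1..s + 1} \<and> i + j < r + s + 2})"
proof -
  let ?x = "Dtilde r s D"
  let ?\<sigma> = "\<lambda>k h. - ?x k (h - 1) + ?x k h + ?x k (h + 1) - ?x k (h + 2)"
  let ?M = "(\<lambda>(k, h). ?\<sigma> k h) ` Sigma {1, 2} (\<lambda>k. {1..2 * rk r s k})"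
  define G where "G = {(i, 0, Dtilde r s D 1 (2 * i)) | i. i \<in> {1..r + 1}} \<union>
       {(0, j, Dtilde r s D 2 (2 * j)) | j. j \<in> {1..s + 1}} \<union>
       {(i, j, Dtilde r s D 1 (2 * i - 1) + Dtilde r s D 2 (2 * j - 1)) | i j.
          i \<in> {1..r + 1} \<and> j \<in> {1..s + 1} \<and> i + j < r + s + 2}"
  have rk [simp]: "rk r s 1 = r" "rk r s (Suc 0) = r" "rk r s 2 = s"
    by (simp_all add: rk_def)
  have q: "q = r + s + 1" and p: "r + s + 2 \<le> p"
    using assms(1-4) by auto
  have color: "D k h \<in> colors p q \<rho> X" if "k \<in> {1, 2}" "h \<in> {1..2 * rk r s k + 2}" for k h
    unfolding Delta using that by blast
  have NSigma: "NSigma p q \<rho> X = semigroup_gen ?M"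
  proof -
    have "root_class p q \<rho> X ` spherical_roots p q \<rho> X
        = (\<lambda>(k, h). root_class p q \<rho> X (root_char p q (sigma p q k h))) ` Sigma {1, 2} (\<lambda>k. {1..2 * rk r s k})"
      unfolding Sigma Collect_pair_image[of _ "{1, 2}"] image_image
      by (rule image_cong) auto
    also have "\<dots> = ?M"
      using root_expansion by (intro image_cong refl) (auto simp del: One_nat_def)
    finally show ?thesis by (simp add: NSigma_def)
  qed

  \<comment> \<open>Distinctness of the colors\<close>
  note sigma_inj = sigma_inj[where p = p and q = q and r = r and s = s]
  have sigma_avoids: "sigma p q k h \<noteq> SRp (p - r - 1)" "sigma p q k h \<noteq> SRp (s + 1)"
    if "k \<in> {1, 2}" "h \<in> {1..2 * rk r s k}" for k h
    by (rule sigma_neq_SRp[OF that]; use p in simp)+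
  \<comment> \<open>Intersecting with the index range treats the first and last colors, moved by a
    single root, like the middle ones.\<close>
  have movers: "movers p q \<rho> (D k h) = sigma p q k ` ({h - 1, h} \<inter> {1..2 * rk r s k})"
    if "k \<in> {1, 2}" "h \<in> {1..2 * rk r s k + 1}" for k h
  proof -
    note kh = that
    have "D k h \<in> colors p q \<rho> X" and "0 < rk r s k"
      using kh assms(1,2) by (auto intro!: color)
    consider "h = 1" | "h \<in> {2..2 * rk r s k}" | "h = 2 * rk r s k + 1" using kh(2) by force
    then show ?thesis
    proof cases
      case 1
      with that \<open>0 < rk r s k\<close> have "{h - 1, h} \<inter> {1..2 * rk r s k} = {1}" by auto
      with 1 first_color[OF that(1) \<open>D k h \<in> _\<close>] show ?thesis by simp
    next
      case 2
      then have "{h - 1, h} \<inter> {1..2 * rk r s k} = {h - 1, h}" by auto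
      with middle_color[OF that(1) 2 \<open>D k h \<in> _\<close>] show ?thesis by simp
    next
      case 3
      with that \<open>0 < rk r s k\<close> have "{h - 1, h} \<inter> {1..2 * rk r s k} = {2 * rk r s k}" by auto
      with 3 last_color[OF that(1) \<open>D k h \<in> _\<close>] show ?thesis by simp
    qed
  qed
  \<comment> \<open>The movers determine the color: the chains use disjoint sets of roots, which
    gives \<open>k\<close>, and inside a chain the index set gives \<open>h\<close>. The two extra
    colors, which may coincide, are kept apart.\<close>
  have D_inj: "D k h = D k' h' \<longleftrightarrow> k = k' \<and> h = h'"
    if k: "k \<in> {1, 2}" "k' \<in> {1, 2}" and h: "h \<in> {1..2 * rk r s k + 1}" "h' \<in> {1..2 * rk r s k' + 1}"
    for k k' h h'
  proof
    assume "D k h = D k' h'"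
    define A where "A k h = {h - 1, h} \<inter> {1..2 * rk r s k}" for k h
    have eq: "sigma p q k ` A k h = sigma p q k' ` A k' h'"
      using movers[OF k(1) h(1)] movers[OF k(2) h(2)] \<open>D k h = D k' h'\<close> by (simp add: A_def)
    have pos: "0 < rk r s k" using k(1) assms(1,2) by auto
    then have "A k h \<noteq> {}" using h(1) by (cases "h = 2 * rk r s k + 1") (auto simp: A_def)
    with eq obtain i j where "i \<in> A k h" "j \<in> A k' h'" "sigma p q k i = sigma p q k' j" by blast
    then have kk: "k = k'" using sigma_inj[of k i k' j] k p q by (simp add: A_def)
    have "A k h = A k h'"
    proof -
      have "inj_on (sigma p q k) {1..2 * rk r s k}"
        using sigma_inj[OF _ k(1) k(1)] p q by (intro inj_onI) auto
      moreover have "A k h \<subseteq> {1..2 * rk r s k}" "A k h' \<subseteq> {1..2 * rk r s k}"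
        by (auto simp: A_def)
      ultimately show ?thesis
        using eq unfolding kk[symmetric] by (simp add: inj_on_image_eq_iff)
    qed
    then have "h = h'" unfolding A_def
    proof (rule consecutive_pair_inj)
      show "2 \<le> 2 * rk r s k" using pos by linarith
      show "h' \<in> {1..2 * rk r s k + 1}" using h(2) by (simp only: kk)
    qed (rule h(1))
    with kk show "k = k' \<and> h = h'" ..
  qed simp
  have D_extra: "D k h \<noteq> D 1 (2 * r + 2)" "D k h \<noteq> D 2 (2 * s + 2)"
    if "k \<in> {1, 2}" "h \<in> {1..2 * rk r s k + 1}" for k h
  proof -
    have "D k h \<in> colors p q \<rho> X" using that by (auto intro!: color)
    moreover have "SRp (p - r - 1) \<notin> movers p q \<rho> (D k h)" "SRp (s + 1) \<notin> movers p q \<rho> (D k h)"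
      using sigma_avoids[OF that(1), THEN not_sym] unfolding movers[OF that] by blast+
    ultimately show "D k h \<noteq> D 1 (2 * r + 2)" "D k h \<noteq> D 2 (2 * s + 2)"
      using extra_color_1 extra_color_2 by auto
  qed

  \<comment> \<open>Expansion in the basis of colors\<close>
  have x0: "?x k 0 = 0" for k by (simp add: Dtilde_def)
  have x: "?x k h = frag_of (D k h)" if "h \<in> {1..2 * rk r s k}" for k h
    using that by (simp add: Dtilde_def ext_color_def)
  have x_top: "?x 1 (2 * r + 1) = frag_of (D 1 (2 * r + 1)) + frag_of (D 1 (2 * r + 2))"
    "?x 1 (2 * r + 2) = frag_of (D 1 (2 * r + 2)) + frag_of (D 2 (2 * s + 1))"
    "?x 2 (2 * s + 1) = frag_of (D 2 (2 * s + 1)) + frag_of (D 2 (2 * s + 2))"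
    "?x 2 (2 * s + 2) = frag_of (D 2 (2 * s + 2)) + frag_of (D 1 (2 * r + 1))"
    by (simp_all add: Dtilde_def ext_color_def rk_def)
  \<comment> \<open>Each extra color cancels in the difference of its own chain, leaving the last
    colors \<open>D 1 (2 * r + 1)\<close> and \<open>D 2 (2 * s + 1)\<close> with opposite
    signs.\<close>
  have \<delta>: "?x 2 (2 * s + 2) - ?x 2 (2 * s + 1) = - (?x 1 (2 * r + 2) - ?x 1 (2 * r + 1))"
    unfolding x_top by simp
  have Dp: "D_p p q r s \<rho> X x0 1 = ?x 1 2" "D_p p q r s \<rho> X x0 2 = ?x 2 2"
    using x[of 2 1] x[of 2 2] D_p1 D_p2 assms(1,2) by simp_all
  have \<sigma>: "?\<sigma> k h \<in> semigroup_gen ?M" if "k \<in> {1, 2}" "h \<in> {1..2 * rk r s k}" for k h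
    using that by (intro semigroup_gen_base image_eqI[of _ _ "(k, h)"]) auto

  have NDelta_0: "0 \<in> NDelta p q \<rho> X" by (simp add: NDelta_def ZDelta_def)
  have NDelta_add: "E + F \<in> NDelta p q \<rho> X" if "E \<in> NDelta p q \<rho> X" "F \<in> NDelta p q \<rho> X" for E F
    using that Poly_Mapping.keys_add[of E F] by (auto simp: NDelta_def ZDelta_def lookup_add)
  have "?x k h \<in> NDelta p q \<rho> X" if "k \<in> {1, 2}" "h \<in> {1..2 * rk r s k + 2}" for k h
  proof -
    have of: "frag_of (D k h) \<in> NDelta p q \<rho> X" if "k \<in> {1, 2}" "h \<in> {1..2 * rk r s k + 2}" for k h
      using color[OF that] by (simp add: NDelta_def ZDelta_def)
    note kh = that
    consider "h \<in> {1..2 * rk r s k}" | "h = 2 * rk r s k + 1" | "h = 2 * rk r s k + 2"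
      using kh(2) by force
    then show ?thesis
      using kh by cases (auto simp: x x_top[simplified] intro!: of NDelta_add)
  qed
  note x_NDelta = this

  define \<Gamma> where "\<Gamma> = Gamma_p p q r s \<rho> X x0"
  have \<Gamma>: "(n1, n2, E) \<in> \<Gamma> \<longleftrightarrow> E \<in> NDelta p q \<rho> X \<and>
      frag_cmul (int n1) (?x 1 2) + frag_cmul (int n2) (?x 2 2) - E \<in> semigroup_gen ?M" for n1 n2 E
    by (simp only: \<Gamma>_def Gamma_p_def le_Sigma_def NSigma Dp mem_Collect_eq prod.case)
  have "\<Gamma> = semigroup_gen G"
  proof
    show "semigroup_gen G \<subseteq> \<Gamma>"
    proof (rule semigroup_gen_subset)
      show "0 \<in> \<Gamma>"
        using NDelta_0 by (simp add: zero_prod_def \<Gamma> semigroup_gen.zero)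
    next
      fix a b assume ab: "a \<in> \<Gamma>" "b \<in> \<Gamma>"
      obtain a1 a2 E b1 b2 F where eq: "a = (a1, a2, E)" "b = (b1, b2, F)" by (metis prod_cases3)
      have "(frag_cmul (int a1) (?x 1 2) + frag_cmul (int a2) (?x 2 2) - E)
          + (frag_cmul (int b1) (?x 1 2) + frag_cmul (int b2) (?x 2 2) - F) \<in> semigroup_gen ?M"
        using ab by (intro semigroup_gen_plus) (simp_all only: eq \<Gamma>)
      also have "(frag_cmul (int a1) (?x 1 2) + frag_cmul (int a2) (?x 2 2) - E)
          + (frag_cmul (int b1) (?x 1 2) + frag_cmul (int b2) (?x 2 2) - F)
        = frag_cmul (int (a1 + b1)) (?x 1 2) + frag_cmul (int (a2 + b2)) (?x 2 2) - (E + F)"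
        by (simp add: frag_cmul_distrib algebra_simps)
      finally show "a + b \<in> \<Gamma>"
        using ab NDelta_add by (simp only: eq add_Pair \<Gamma>)
    next
      have even1: "frag_cmul (int i) (?x 1 2) - ?x 1 (2 * i) \<in> semigroup_gen ?M"
        if "i \<in> {1..r + 1}" for i
        using that \<sigma>[of 1] by (intro even_chain_closure[where R = r] x0) auto
      have even2: "frag_cmul (int j) (?x 2 2) - ?x 2 (2 * j) \<in> semigroup_gen ?M"
        if "j \<in> {1..s + 1}" for j
        using that \<sigma>[of 2] by (intro even_chain_closure[where R = s] x0) auto
      \<comment> \<open>Each chain alone closes only up to its last difference; in the sum these two
        corrections cancel.\<close>
      have odd: "frag_cmul (int i) (?x 1 2) + frag_cmul (int j) (?x 2 2)
          - (?x 1 (2 * i - 1) + ?x 2 (2 * j - 1)) \<in> semigroup_gen ?M"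
        if "i \<in> {1..r + 1}" "j \<in> {1..s + 1}" for i j
      proof -
        have "frag_cmul (int i) (?x 1 2) - ?x 1 (2 * i - 1) - (?x 1 (2 * r + 2) - ?x 1 (2 * r + 1))
            \<in> semigroup_gen ?M"
          using that \<sigma>[of 1] by (intro odd_chain_closure x0) auto
        moreover have "frag_cmul (int j) (?x 2 2) - ?x 2 (2 * j - 1) - (?x 2 (2 * s + 2) - ?x 2 (2 * s + 1))
            \<in> semigroup_gen ?M"
          using that \<sigma>[of 2] by (intro odd_chain_closure x0) auto
        ultimately have "(frag_cmul (int i) (?x 1 2) - ?x 1 (2 * i - 1) - (?x 1 (2 * r + 2) - ?x 1 (2 * r + 1)))
          + (frag_cmul (int j) (?x 2 2) - ?x 2 (2 * j - 1) - (?x 2 (2 * s + 2) - ?x 2 (2 * s + 1)))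
            \<in> semigroup_gen ?M" by (rule semigroup_gen_plus)
        then show ?thesis unfolding \<delta> by (simp add: algebra_simps)
      qed
      show "G \<subseteq> \<Gamma>"
      proof -
        have "(i, 0, ?x 1 (2 * i)) \<in> \<Gamma>" if "i \<in> {1..r + 1}" for i
          using even1[OF that] x_NDelta[of 1 "2 * i"] that unfolding \<Gamma> by simp
        moreover have "(0, j, ?x 2 (2 * j)) \<in> \<Gamma>" if "j \<in> {1..s + 1}" for j
          using even2[OF that] x_NDelta[of 2 "2 * j"] that unfolding \<Gamma> by simp
        moreover have "(i, j, ?x 1 (2 * i - 1) + ?x 2 (2 * j - 1)) \<in> \<Gamma>"
          if "i \<in> {1..r + 1}" "j \<in> {1..s + 1}" for i j
        proof -
          have "?x 1 (2 * i - 1) \<in> NDelta p q \<rho> X" "?x 2 (2 * j - 1) \<in> NDelta p q \<rho> X"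
            using that by (auto intro!: x_NDelta)
          then show ?thesis unfolding \<Gamma> using odd[OF that] NDelta_add by blast
        qed
        ultimately show ?thesis unfolding G_def by blast
      qed
    qed
  next
    show "\<Gamma> \<subseteq> semigroup_gen G"
    proof
      fix a assume "a \<in> \<Gamma>"
      moreover obtain n1 n2 E where a: "a = (n1, n2, E)" by (rule prod_cases3)
      ultimately have E: "E \<in> NDelta p q \<rho> X"
        and "frag_cmul (int n1) (?x 1 2) + frag_cmul (int n2) (?x 2 2) - E \<in> semigroup_gen ?M"
        by (simp_all only: \<Gamma>)
      from this(2) obtain c where "frag_cmul (int n1) (?x 1 2) + frag_cmul (int n2) (?x 2 2) - E
          = (\<Sum>t\<in>Sigma {1, 2} (\<lambda>k. {1..2 * rk r s k}). frag_cmul (int (c t)) (case t of (k, h) \<Rightarrow> ?\<sigma> k h))"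
        by (rule semigroup_gen_image_sum[rotated]) auto
      also have "\<dots> = (\<Sum>k\<in>{1, 2}. \<Sum>h=1..2 * rk r s k. frag_cmul (int (c (k, h))) (?\<sigma> k h))"
        by (subst sum.Sigma) (auto intro!: sum.cong)
      finally have E_eq: "E = (frag_cmul (int n1) (?x 1 2) - (\<Sum>h=1..2 * r. frag_cmul (int (c (1, h))) (?\<sigma> 1 h)))
          + (frag_cmul (int n2) (?x 2 2) - (\<Sum>h=1..2 * s. frag_cmul (int (c (2, h))) (?\<sigma> 2 h)))"
        by (simp add: algebra_simps)
      obtain z g where z: "frag_cmul (int n1) (?x 1 2) - (\<Sum>h=1..2 * r. frag_cmul (int (c (1, h))) (?\<sigma> 1 h))
          = (\<Sum>h=1..2 * r. frag_cmul (z h) (?x 1 h)) + frag_cmul (int g) (?x 1 (2 * r + 2))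
            + frag_cmul (\<Sum>i=1..r. z (2 * i - 1)) (?x 1 (2 * r + 2) - ?x 1 (2 * r + 1))"
        and n1: "int n1 = (\<Sum>i=1..r. z (2 * i - 1) * int i) + (\<Sum>i=1..r. z (2 * i) * int i)
          + int g * int (r + 1)"
        by (rule chain_normal_form[where x = "?x 1", OF x0])
      obtain w f where w: "frag_cmul (int n2) (?x 2 2) - (\<Sum>h=1..2 * s. frag_cmul (int (c (2, h))) (?\<sigma> 2 h))
          = (\<Sum>h=1..2 * s. frag_cmul (w h) (?x 2 h)) + frag_cmul (int f) (?x 2 (2 * s + 2))
            + frag_cmul (\<Sum>j=1..s. w (2 * j - 1)) (?x 2 (2 * s + 2) - ?x 2 (2 * s + 1))"
        and n2: "int n2 = (\<Sum>j=1..s. w (2 * j - 1) * int j) + (\<Sum>j=1..s. w (2 * j) * int j)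
          + int f * int (s + 1)"
        by (rule chain_normal_form[where x = "?x 2", OF x0])
      note E_eq = E_eq[unfolded z w]
      have nonneg: "0 \<le> Poly_Mapping.lookup E Z" for Z using E by (simp add: NDelta_def)
      \<comment> \<open>Below the last elements each \<open>?x k h\<close> is a single color, so
        \<open>z\<close> and \<open>w\<close> are read off directly. The last color of a chain also
        receives the last element of the other chain and both last differences. Extra colors do not
        contribute here, whether or not they coincide.\<close>
      have coeff: "Poly_Mapping.lookup E (D k h) = (\<Sum>i=1..2 * r. z i * of_bool (k = 1 \<and> h = i))
          + (\<Sum>j=1..2 * s. w j * of_bool (k = 2 \<and> h = j))
          + (int g + (\<Sum>i=1..r. z (2 * i - 1)) - (\<Sum>j=1..s. w (2 * j - 1))) * of_bool (k = 2 \<and> h = 2 * s + 1)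
          + (int f + (\<Sum>j=1..s. w (2 * j - 1)) - (\<Sum>i=1..r. z (2 * i - 1))) * of_bool (k = 1 \<and> h = 2 * r + 1)"
        if k: "k \<in> {1, 2}" and h: "h \<in> {1..2 * rk r s k + 1}" for k h
      proof -
        have "(\<Sum>i=1..2 * r. z i * Poly_Mapping.lookup (?x 1 i) (D k h)) = (\<Sum>i=1..2 * r. z i * of_bool (k = 1 \<and> h = i))"
          using D_inj[OF k _ h, of 1] by (intro sum.cong) (auto simp: x)
        moreover have "(\<Sum>j=1..2 * s. w j * Poly_Mapping.lookup (?x 2 j) (D k h)) = (\<Sum>j=1..2 * s. w j * of_bool (k = 2 \<and> h = j))"
          using D_inj[OF k _ h, of 2] by (intro sum.cong) (auto simp: x)
        moreover have "D k h = D 1 (2 * r + 1) \<longleftrightarrow> k = 1 \<and> h = 2 * r + 1"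
          "D k h = D 2 (2 * s + 1) \<longleftrightarrow> k = 2 \<and> h = 2 * s + 1"
          using D_inj[OF k _ h, of 1 "2 * r + 1"] D_inj[OF k _ h, of 2 "2 * s + 1"] by simp_all
        ultimately show ?thesis
          using D_extra[OF k h] unfolding E_eq x_top
          by (simp add: lookup_add lookup_minus lookup_sum algebra_simps)
      qed
      have "(n1, n2, E) \<in> semigroup_gen G"
      proof (rule two_chains_decomposition[OF _ _ _ \<delta> _ _ _ _ n1 n2 E_eq])
        show "0 \<le> z h" if "h \<in> {1..2 * r}" for h
          using nonneg[of "D 1 h"] coeff[of 1 h] that by (simp add: sum.delta)
        show "0 \<le> w h" if "h \<in> {1..2 * s}" for h
          using nonneg[of "D 2 h"] coeff[of 2 h] that by (simp add: sum.delta)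
        \<comment> \<open>Nonnegativity at the last color of the first chain bounds its odd part by
          means of \<open>f\<close>, the multiplicity of the last element of the second chain; the
          other bound is symmetric.\<close>
        show "(\<Sum>i=1..r. z (2 * i - 1)) \<le> (\<Sum>j=1..s. w (2 * j - 1)) + int f"
          using nonneg[of "D 1 (2 * r + 1)"] coeff[of 1 "2 * r + 1"] by simp
        show "(\<Sum>j=1..s. w (2 * j - 1)) \<le> (\<Sum>i=1..r. z (2 * i - 1)) + int g"
          using nonneg[of "D 2 (2 * s + 1)"] coeff[of 2 "2 * s + 1"] by simp
      qed (auto simp: G_def intro!: semigroup_gen_base)
      then show "a \<in> semigroup_gen G" by (simp add: a)
    qed
  qed
  then show ?thesis by (simp only: G_def \<Gamma>_def)
qed

end
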